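(* Let $k$ be a field, let $n\ge 4$, and let $\mathcal A=\{d_1,\ldots,d_n\}\subset\mathbb Z^+$ be such that $\mathcal A\setminus\{d_n\}=\{d_1,\ldots,d_{n-1}\}$ is a generalized arithmetic sequence, $\gcd(\mathcal A)=1$, and the numerical semigroup $\mathcal S=\sum_{i=1}^n\mathbb N d_i$ is minimally generated by $\mathcal A$. Then $I_{\mathcal A}$ is a complete intersection if and only if $n=4$ and one of the following holds: 1. $d_1/\gcd\{d_1,d_2\}$ is even and $\gcd\{d_1,d_2\}\,d_4\in\mathbb N\{d_1,d_2,d_3\}$; or 2. $d_1$ and $d_4$ are even and $\mathcal C_{red}=\emptyset$, where $\mathcal C=\{d_1,d_3,d_4\}$.
   Context: $\mathbb N$ denotes the nonnegative integers and $\mathbb Z^+$ the positive integers; $\mathbb N\{b_1,\ldots,b_s\}=\mathbb N b_1+\cdots+\mathbb N b_s$. For $\mathcal A=\{d_1,\ldots,d_n\}\subset\mathbb Z^+$, the toric ideal $I_{\mathcal A}$ is the kernel of the $k$-algebra homomorphism $k[x_1,\ldots,x_n]\to k[t]$, $x_i\mapsto t^{d_i}$. It has height $n-1$; it is a complete intersection if its minimal number of generators equals $n-1$. $\{d_1,\ldots,d_m\}$ is a generalized arithmetic sequence if there exists $h\in\mathbb Z^+$ such that $hd_1,d_2,\ldots,d_m$ is an increasing arithmetic sequence. $\mathcal S$ is minimally generated by $\mathcal A$ if $d_i\notin\sum_{j\ne i}\mathbb N d_j$ for every $i$. Definition of $\mathcal B_{red}$ for a finite family $\mathcal B=\{b_1,\ldots,b_s\}$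 of positive integers: starting from $\mathcal B$, apply iteratively the following operations as long as one of them changes the family: (i) if $b_i\notin\sum_{j\ne i}\mathbb Q b_j$ (which for positive integers happens only when $b_i$ is the only element of the family), remove $b_i$; (ii) if $b_i\in\sum_{j\neq i}\mathbb N b_j$, remove $b_i$; (iii) if $b_i\in\sum_{j\ne i}\mathbb Q b_j$, replace $b_i$ by $B_ib_i$, where $B_i=\min\{B\in\mathbb Z^+ : Bb_i\in\sum_{j\ne i}\mathbb Z b_j\}=\gcd(\mathcal B\setminus\{b_i\})/\gcd(\mathcal B)$. The final result, which is uniquely determined by $\mathcal B$, is $\mathcal B_{red}$; it is either empty or a family $\{b_1',\ldots,b_r'\}$ with $b_i'\in\sum_{j\neq i}\mathbb Z b_j'\setminus\sum_{j\ne i}\mathbb N b_j'$ for all $i$. *)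

theory Defs
  imports
    "HOL-Library.Poly_Mapping"
    "HOL-Library.Multiset"
    "HOL-Algebra.Algebraic_Closure_Type"
    "HOL-Computational_Algebra.Polynomial"
begin

section \<open>Linear combinations of positive integers\<close>

text \<open>The type \<open>'a\<close> of the result selects the coefficients: at type \<open>nat\<close> this is
  \<open>\<nat>B\<close>, at \<open>int\<close> it is \<open>\<int>B\<close>, and at \<open>rat\<close> it is \<open>\<rat>B\<close>.\<close>

definition lin_combs :: "nat set \<Rightarrow> 'a::comm_semiring_1 set" where
  "lin_combs B = {\<Sum>b\<in>B. c b * of_nat b | c. True}"

definition minimal_generators :: "nat \<Rightarrow> (nat \<Rightarrow> nat) \<Rightarrow> bool" where
  "minimal_generators n d \<longleftrightarrow> (\<forall>i\<in>{1..n}. d i \<notin> lin_combs (d ` ({1..n} - {i})))"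

definition increasing_arith_seq :: "nat \<Rightarrow> (nat \<Rightarrow> nat) \<Rightarrow> bool" where
  "increasing_arith_seq m s \<longleftrightarrow> (\<exists>e>0. \<forall>i\<in>{1..<m}. s (Suc i) = s i + e)"

definition generalized_arith_seq :: "nat \<Rightarrow> (nat \<Rightarrow> nat) \<Rightarrow> bool" where
  "generalized_arith_seq m d \<longleftrightarrow> (\<exists>h>0. increasing_arith_seq m (d(1 := h * d 1)))"


section \<open>Toric ideals\<close>

text \<open>A polynomial maps exponent vectors to coefficients; an exponent vector maps indices of
  variables to exponents. The variables of \<open>k[x\<^sub>1, \<dots>, x\<^sub>n]\<close> have the indices \<open>1, \<dots>, n\<close>.\<close>

type_synonym 'k mpoly = "(nat \<Rightarrow>\<^sub>0 nat) \<Rightarrow>\<^sub>0 'k"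

definition mpoly_ring :: "nat \<Rightarrow> ('k::field mpoly) ring" where
  "mpoly_ring n = ring_of_type_algebra
     \<lparr>carrier := {p. \<forall>m\<in>Poly_Mapping.keys p. Poly_Mapping.keys m \<subseteq> {1..n}}\<rparr>"

definition toric_map :: "(nat \<Rightarrow> nat) \<Rightarrow> 'k::field mpoly \<Rightarrow> 'k poly" where
  "toric_map d p = (\<Sum>m\<in>Poly_Mapping.keys p. Polynomial.smult (Poly_Mapping.lookup p m)
     (\<Prod>i\<in>Poly_Mapping.keys m. Polynomial.monom 1 (d i) ^ Poly_Mapping.lookup m i))"

definition toric_ideal :: "nat \<Rightarrow> (nat \<Rightarrow> nat) \<Rightarrow> 'k::field mpoly set" where
  "toric_ideal n d = a_kernel (mpoly_ring n) (ring_of_type_algebra :: 'k poly ring) (toric_map d)"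

definition min_num_generators :: "('a, 'b) ring_scheme \<Rightarrow> 'a set \<Rightarrow> nat" where
  "min_num_generators R I =
     (LEAST r. \<exists>G. G \<subseteq> carrier R \<and> finite G \<and> card G = r \<and> Idl\<^bsub>R\<^esub> G = I)"

text \<open>The height of the toric ideal of \<open>n\<close> positive integers is \<open>n - 1\<close>.\<close>

definition toric_complete_intersection :: "'k::field itself \<Rightarrow> nat \<Rightarrow> (nat \<Rightarrow> nat) \<Rightarrow> bool" where
  "toric_complete_intersection _ n d \<longleftrightarrow>
     min_num_generators (mpoly_ring n) (toric_ideal n d :: 'k mpoly set) = n - 1"


section \<open>The reduced family\<close>

text \<open>Families are multisets, because an operation may make two members equal. In the rules,
  \<open>R\<close> consists of the members of the family other than \<open>b\<close>.\<close>

definition red_factor :: "nat \<Rightarrow> nat multiset \<Rightarrow> nat" where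
  "red_factor b R = (LEAST B. B > 0 \<and> int (B * b) \<in> lin_combs (set_mset R))"

inductive red_step :: "nat multiset \<Rightarrow> nat multiset \<Rightarrow> bool" where
  remove_independent:
    "(of_nat b :: rat) \<notin> lin_combs (set_mset R) \<Longrightarrow> red_step (add_mset b R) R"
| remove_redundant:
    "b \<in> lin_combs (set_mset R) \<Longrightarrow> red_step (add_mset b R) R"
| multiply:
    "(of_nat b :: rat) \<in> lin_combs (set_mset R) \<Longrightarrow> red_factor b R * b \<noteq> b \<Longrightarrow>
     red_step (add_mset b R) (add_mset (red_factor b R * b) R)"

text \<open>The operations terminate and are confluent on families of positive integers, so the
  normal form is unique.\<close>

definition reduced_family :: "nat multiset \<Rightarrow> nat multiset" where
  "reduced_family M = (THE N. red_step\<^sup>*\<^sup>* M N \<and> (\<nexists>N'. red_step N N'))"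

end

theory Submission
  imports Defs "HOL-Library.Function_Algebras"
begin

text \<open>Let \<open>\<mm>\<close> be the ideal of the variables. Counting generators in \<open>I / \<mm>I\<close> turns the theorem into
  combinatorics: the minimal number of generators is the size of any minimal set of binomials that joins, in
  every degree, the classes of monomials linked by common variables. If \<open>n - 1\<close> binomials
  generate the ideal, evaluation at 0/1 points shows that for every set \<open>C\<close> of variables fewer than
  \<open>card C\<close> of them have both sides divisible by a variable in \<open>C\<close>. The arithmetic sequence makes
  \<open>x\<^sub>2\<^sup>2 - x\<^sub>1\<^sup>h x\<^sub>3\<close> a possible generator, and for \<open>n \<ge> 5\<close> also \<open>x\<^sub>3\<^sup>2 - x\<^sub>2 x\<^sub>4\<close>; then \<open>C = {2, 3}\<close>
  contradicts the bound. For \<open>n = 4\<close> the bound leaves few possible supports for the other two generators: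
  one of them is \<open>x\<^sub>l\<^sup>r - \<dots>\<close> with \<open>l \<noteq> 2\<close>, and the other one contains neither \<open>x\<^sub>l\<close> nor \<open>x\<^sub>2\<close>. The case
  \<open>l = 4\<close> gives the first condition, the other cases the second one. Conversely, both conditions provide
  generators that rewrite every monomial to a unique normal form.\<close>

section \<open>Exponents and weights\<close>

text \<open>The bound on \<open>C\<close> comes from geometry: if \<open>x_i = 0\<close> for all
  \<open>i\<close> in \<open>C\<close>, a nonempty set, the toric curve is left with the origin, and
  dead generators vanish identically, so the others have to cut the remaining
  \<open>n - card C\<close> coordinates down to a point. Tracking which coordinates of a 0/1 point
  vanish replaces dimension theory here. Since a minimal generating set need not consist of
  binomials, the bound is applied to a special set of binomials (\<open>star\<close>) whose size no
  generating set can undercut. It can be made to contain prescribed binomials; those with a square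
  such as \<open>x_2^2\<close> qualify because minimality of the weights leaves the square alone in
  its class.

  When the supports are known, arithmetic enters through the lattice: the three exponent differences
  span all integer relations among the weights, so one coordinate of a Bezout relation yields parity
  or divisibility. Both conditions describe gluings. In the first, \<open>d 4\<close> is glued to
  \<open>d 1\<close>, \<open>d 2\<close>, \<open>d 3\<close>, and parity glues \<open>d 2\<close> to
  \<open>d 1\<close>, \<open>d 3\<close>; in the second, \<open>d 2\<close> is glued to
  \<open>d 1\<close>, \<open>d 3\<close>, \<open>d 4\<close>, and the empty reduced family says that
  this triple is itself a gluing.\<close>

type_synonym exponent = "nat \<Rightarrow>\<^sub>0 nat"

abbreviation (input) "lookup \<equiv> Poly_Mapping.lookup"
abbreviation (input) "keys \<equiv> Poly_Mapping.keys"
abbreviation (input) "single \<equiv> Poly_Mapping.single"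

definition exponents :: "nat \<Rightarrow> exponent set" where
  "exponents n = {u. keys u \<subseteq> {1..n}}"

definition weight :: "(nat \<Rightarrow> nat) \<Rightarrow> exponent \<Rightarrow> nat" where
  "weight d u = (\<Sum>i\<in>keys u. lookup u i * d i)"

lemma keys_add_nat: "keys (u + v) = keys u \<union> keys v" for u v :: exponent
  by (auto simp: in_keys_iff lookup_add)

lemma weight_eq_sum: "finite A \<Longrightarrow> keys u \<subseteq> A \<Longrightarrow> weight d u = (\<Sum>i\<in>A. lookup u i * d i)"
  unfolding weight_def by (rule sum.mono_neutral_left) (auto simp: in_keys_iff)

lemma weight_zero [simp]: "weight d 0 = 0"
  by (simp add: weight_def)

lemma weight_single [simp]: "weight d (single i k) = k * d i"
  by (simp add: weight_def)

lemma weight_add [simp]: "weight d (u + v) = weight d u + weight d v"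
proof -
  have "weight d x = (\<Sum>i\<in>keys u \<union> keys v. lookup x i * d i)"
    if "keys x \<subseteq> keys u \<union> keys v" for x
    using that by (intro weight_eq_sum) auto
  then show ?thesis
    by (simp add: keys_add_nat lookup_add sum.distrib distrib_right)
qed

lemma exponents_zero [simp]: "0 \<in> exponents n"
  by (simp add: exponents_def)

lemma exponents_add [simp]: "u + v \<in> exponents n \<longleftrightarrow> u \<in> exponents n \<and> v \<in> exponents n"
  by (simp add: exponents_def keys_add_nat)

lemma exponents_single: "i \<in> {1..n} \<Longrightarrow> single i k \<in> exponents n"
  by (simp add: exponents_def)

lemma exponents_keysD: "u \<in> exponents n \<Longrightarrow> i \<in> keys u \<Longrightarrow> i \<in> {1..n}"
  by (auto simp: exponents_def)

lemma exponent_split: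
  fixes u :: exponent
  assumes "k \<le> lookup u i"
  obtains u' where "u = u' + single i k"
proof
  show "u = (u - single i k) + single i k"
    using assms by (auto intro!: poly_mapping_eqI simp: lookup_add lookup_minus lookup_single when_def)
qed

lemma finite_bounded_exponents: "finite {u \<in> exponents n. \<forall>i. lookup u i \<le> D}"
proof (rule finite_imageD)
  have "lookup ` {u \<in> exponents n. \<forall>i. lookup u i \<le> D} \<subseteq>
      {f. \<forall>x. (x \<in> {1..n} \<longrightarrow> f x \<in> {..D}) \<and> (x \<notin> {1..n} \<longrightarrow> f x = 0)}"
    by (auto simp: exponents_def in_keys_iff subset_iff)
  then show "finite (lookup ` {u \<in> exponents n. \<forall>i. lookup u i \<le> D})"
    by (rule finite_subset) (intro finite_set_of_finite_funs finite_atLeastAtMost finite_atMost)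
qed (auto simp: inj_on_def intro: poly_mapping_eqI)

section \<open>Binomial presentations\<close>

text \<open>This is the congruence on monomials generated by \<open>B\<close>: for linked
  \<open>u\<close> and \<open>v\<close> the difference of the monomials lies in the ideal generated
  by the binomials of \<open>B\<close>.\<close>

inductive linked :: "nat \<Rightarrow> (exponent \<times> exponent) set \<Rightarrow> exponent \<Rightarrow> exponent \<Rightarrow> bool"
  for n B where
  linked_move: "(u, v) \<in> B \<Longrightarrow> w \<in> exponents n \<Longrightarrow> linked n B (w + u) (w + v)"
| linked_refl: "linked n B u u"
| linked_sym: "linked n B u v \<Longrightarrow> linked n B v u"
| linked_trans: "linked n B u v \<Longrightarrow> linked n B v w \<Longrightarrow> linked n B u w"

lemma linked_add:
  assumes "linked n B u v" "w \<in> exponents n"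
  shows "linked n B (w + u) (w + v)"
  using assms
proof (induction)
  case (linked_move u v w')
  then show ?case
    using linked.linked_move[of u v B "w + w'" n] by (simp add: add.assoc)
qed (blast intro: linked.intros)+

text \<open>The coefficient-free form of the claim that the binomials of \<open>B\<close> generate
  the toric ideal.\<close>

definition presents :: "nat \<Rightarrow> (nat \<Rightarrow> nat) \<Rightarrow> (exponent \<times> exponent) set \<Rightarrow> bool" where
  "presents n d B \<longleftrightarrow>
    (\<forall>(u, v)\<in>B. u \<in> exponents n \<and> v \<in> exponents n \<and> weight d u = weight d v) \<and>
    (\<forall>u\<in>exponents n. \<forall>v\<in>exponents n. weight d u = weight d v \<longrightarrow> linked n B u v)"

lemma presentsD:
  assumes "presents n d B" "(u, v) \<in> B"
  shows "u \<in> exponents n" "v \<in> exponents n" "weight d u = weight d v"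
  using assms unfolding presents_def by auto

lemma presents_linked:
  "presents n d B \<Longrightarrow> u \<in> exponents n \<Longrightarrow> v \<in> exponents n \<Longrightarrow> weight d u = weight d v \<Longrightarrow>
    linked n B u v"
  unfolding presents_def by blast

text \<open>Such a binomial vanishes identically once the variables in \<open>C\<close> are zero, so
  it imposes no condition on the remaining ones.\<close>

definition dead :: "(exponent \<times> exponent) set \<Rightarrow> nat set \<Rightarrow> (exponent \<times> exponent) set" where
  "dead B C = {(u, v) \<in> B. keys u \<inter> C \<noteq> {} \<and> keys v \<inter> C \<noteq> {}}"

section \<open>Monomials modulo common variables\<close>

text \<open>If two monomials of equal weight share \<open>x_i\<close>, their difference is
  \<open>x_i\<close> times a binomial of the toric ideal. Only binomials between different classes
  survive in the quotient that counts generators.\<close>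

inductive conn :: "nat \<Rightarrow> (nat \<Rightarrow> nat) \<Rightarrow> exponent \<Rightarrow> exponent \<Rightarrow> bool" for n d where
  conn_share: "u \<in> exponents n \<Longrightarrow> v \<in> exponents n \<Longrightarrow> weight d u = weight d v \<Longrightarrow>
    i \<in> keys u \<Longrightarrow> i \<in> keys v \<Longrightarrow> conn n d u v"
| conn_refl: "conn n d u u"
| conn_sym: "conn n d u v \<Longrightarrow> conn n d v u"
| conn_trans: "conn n d u v \<Longrightarrow> conn n d v w \<Longrightarrow> conn n d u w"

lemma conn_weight: "conn n d u v \<Longrightarrow> weight d u = weight d v"
  by (induction rule: conn.induct) auto

lemma conn_exponents: "conn n d u v \<Longrightarrow> u \<in> exponents n \<longleftrightarrow> v \<in> exponents n"
  by (induction rule: conn.induct) auto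

text \<open>Being equal to \<open>u\<close> is invariant along every chain, since no other monomial
  of this weight shares a variable with \<open>u\<close>.\<close>

lemma conn_isolated:
  assumes "conn n d u v"
    and "\<And>v i. v \<in> exponents n \<Longrightarrow> weight d v = weight d u \<Longrightarrow> i \<in> keys u \<Longrightarrow> i \<in> keys v \<Longrightarrow> v = u"
  shows "v = u"
proof -
  have "x = u \<longleftrightarrow> y = u" if "conn n d x y" for x y
    using that by (induction rule: conn.induct) (use assms(2) in metis)+
  with assms(1) show ?thesis by blast
qed

lemma conn_class_eq: "conn n d u v \<Longrightarrow> conn n d u = conn n d v"
  by (blast intro: conn_sym conn_trans)

text \<open>A star joins, in every weight, one root to a representative of each other class of \<open>conn\<close>.\<close>
definition star :: "nat \<Rightarrow> (nat \<Rightarrow> nat) \<Rightarrow> (exponent \<times> exponent) set \<Rightarrow> bool" where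
  "star n d B \<longleftrightarrow> finite B \<and> presents n d B \<and>
    (\<forall>(u, v)\<in>B. \<forall>(u', v')\<in>B. \<not> conn n d u v' \<and> (conn n d u u' \<longrightarrow> (u, v) = (u', v')))"

text \<open>Positivity makes sets of bounded weight finite and leaves \<open>0\<close> as the only
  exponent vector of weight 0.\<close>

locale positive_weights =
  fixes n :: nat and d :: "nat \<Rightarrow> nat"
  assumes weights_pos: "i \<in> {1..n} \<Longrightarrow> d i > 0"
begin

lemma lookup_le_weight:
  assumes "u \<in> exponents n"
  shows "lookup u i \<le> weight d u"
proof (cases "i \<in> keys u")
  case True
  then have "lookup u i \<le> lookup u i * d i"
    using weights_pos[of i] exponents_keysD[OF assms True] by simp
  also have "\<dots> \<le> weight d u"
    unfolding weight_def using True by (intro member_le_sum) auto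
  finally show ?thesis .
qed (simp add: in_keys_iff)

lemma weight_pos:
  assumes "u \<in> exponents n" "u \<noteq> 0"
  shows "weight d u > 0"
proof -
  obtain i where "lookup u i \<noteq> 0"
    using assms(2) by (auto simp: poly_mapping_eq_iff fun_eq_iff)
  with lookup_le_weight[OF assms(1), of i] show ?thesis by simp
qed

lemma finite_weight_exponents: "finite {u \<in> exponents n. weight d u \<le> s}"
  by (rule finite_subset[OF _ finite_bounded_exponents[of n s]])
    (use lookup_le_weight order_trans in blast)

text \<open>Set the variables in a growing set \<open>C\<close> to zero: a generator with exactly one side
  meeting \<open>C\<close> forces one more variable into \<open>C\<close> and becomes dead. When no such generator is
  left, all generators vanish at the 0/1 point that is 0 exactly on \<open>C\<close>, so this point lies on the
  toric variety and \<open>C\<close> is everything.\<close>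
lemma card_dead_bound:
  assumes B: "presents n d B" "finite B" and C: "C \<subseteq> {1..n}" "C \<noteq> {}"
  shows "n + card (dead B C) \<le> card C + card B"
  using C
proof (induction "card ({1..n} - C)" arbitrary: C rule: less_induct)
  case less
  have dead_le: "card (dead B C) \<le> card B" for C
    using B(2) by (intro card_mono) (auto simp: dead_def)
  show ?case
  proof (cases "C = {1..n}")
    case True
    then show ?thesis using dead_le[of C] by simp
  next
    case False
    then obtain i j where ij: "i \<in> C" "j \<in> {1..n}" "j \<notin> C"
      using less.prems by blast
    have "\<exists>b\<in>B. \<not> (keys (fst b) \<inter> C \<noteq> {} \<longleftrightarrow> keys (snd b) \<inter> C \<noteq> {})"
    proof (rule ccontr)
      assume closed: "\<not> ?thesis"
      have inv: "keys u \<inter> C \<noteq> {} \<longleftrightarrow> keys v \<inter> C \<noteq> {}" if "linked n B u v" for u v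
        using that
      proof (induction rule: linked.induct)
        case (linked_move u v w)
        with closed have "keys u \<inter> C \<noteq> {} \<longleftrightarrow> keys v \<inter> C \<noteq> {}" by force
        then show ?case by (simp add: keys_add_nat Int_Un_distrib2)
      qed auto
      have "i \<in> {1..n}" using ij less.prems by blast
      \<comment> \<open>\<open>x_i^(d j) - x_j^(d i)\<close> belongs to the ideal, yet exactly one
        of its sides meets \<open>C\<close>.\<close>
      then have "linked n B (single i (d j)) (single j (d i))"
        using ij by (intro presents_linked[OF B(1)]) (auto intro: exponents_single)
      from inv[OF this] ij weights_pos[OF ij(2)] weights_pos[OF \<open>i \<in> {1..n}\<close>] show False
        by simp
    qed
    then obtain u v where uv: "(u, v) \<in> B"
      and one: "\<not> (keys u \<inter> C \<noteq> {} \<longleftrightarrow> keys v \<inter> C \<noteq> {})" by fastforce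
    have wt: "weight d u = weight d v" "u \<in> exponents n" "v \<in> exponents n"
      using presentsD[OF B(1) uv] by auto
    have "u = 0 \<longleftrightarrow> v = 0"
      using weight_pos[of u] weight_pos[of v] wt by (metis less_numeral_extra(3) weight_zero)
    with one have "u \<noteq> 0" "v \<noteq> 0" by auto
    then have "keys u \<noteq> {}" "keys v \<noteq> {}"
      by (auto simp: poly_mapping_eq_iff fun_eq_iff in_keys_iff)
    \<comment> \<open>\<open>k\<close> is taken from the side that misses \<open>C\<close>.\<close>
    then obtain k where k: "k \<in> keys u \<union> keys v" "k \<notin> C"
      "keys u \<inter> insert k C \<noteq> {}" "keys v \<inter> insert k C \<noteq> {}"
      using one by blast
    then have kn: "k \<in> {1..n}" using wt exponents_keysD by blast
    have "finite C" using less.prems(1) finite_subset by blast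
    have "insert (u, v) (dead B C) \<subseteq> dead B (insert k C)"
      using k uv by (auto simp: dead_def)
    then have "card (insert (u, v) (dead B C)) \<le> card (dead B (insert k C))"
      using B(2) by (intro card_mono) (auto simp: dead_def intro: finite_subset[of _ B])
    moreover have "card (insert (u, v) (dead B C)) = Suc (card (dead B C))"
      using one B(2) by (subst card_insert_disjoint)
        (auto simp: dead_def intro: finite_subset[of _ B])
    moreover have "{1..n} - insert k C \<subset> {1..n} - C"
      using k(2) kn by blast
    then have smaller: "card ({1..n} - insert k C) < card ({1..n} - C)"
      by (intro psubset_card_mono) simp_all
    have sub: "insert k C \<subseteq> {1..n}" using less.prems(1) kn by blast
    have "n + card (dead B (insert k C)) \<le> card (insert k C) + card B"
      by (rule less.hyps[OF smaller sub insert_not_empty])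
    moreover have "card (insert k C) = Suc (card C)"
      using k(2) \<open>finite C\<close> by simp
    ultimately show ?thesis by linarith
  qed
qed

text \<open>The case \<open>C = {1}\<close>: this is the height bound.\<close>

lemma card_presentation_ge:
  assumes "presents n d B" "finite B" "n \<ge> 1"
  shows "n - 1 \<le> card B"
  using card_dead_bound[OF assms(1,2), of "{1}"] assms(3) by simp

text \<open>If the exponent of \<open>x_i\<close> exceeds \<open>d j\<close>, trading
  \<open>x_i^(d j)\<close> for \<open>x_j^(d i)\<close> keeps an \<open>x_i\<close> and creates an
  \<open>x_j\<close>; through the new monomial \<open>u\<close> is connected to every
  \<open>v\<close> of its weight that contains \<open>x_j\<close>. The bound makes stars
  finite.\<close>

lemma not_conn_bounded:
  assumes u: "u \<in> exponents n" and v: "v \<in> exponents n" and wt: "weight d u = weight d v"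
    and "\<not> conn n d u v"
  shows "lookup u i \<le> (\<Sum>j\<in>{1..n}. d j)"
proof (rule ccontr)
  assume big: "\<not> ?thesis"
  then have i: "i \<in> keys u" by (auto simp: in_keys_iff)
  then have "weight d u > 0" using weight_pos[OF u] by (metis empty_iff keys_zero)
  then have "v \<noteq> 0" using wt by auto
  then obtain j where j: "j \<in> keys v" using keys_eq_empty by blast
  have i': "i \<in> {1..n}" and j': "j \<in> {1..n}"
    using exponents_keysD[OF u i] exponents_keysD[OF v j] .
  have "d j \<le> (\<Sum>j\<in>{1..n}. d j)" using j' by (intro member_le_sum) auto
  with big have less: "d j < lookup u i" by linarith
  obtain u' where u': "u = u' + single i (d j)"
    by (rule exponent_split[OF less_imp_le[OF less]])
  define w where "w = u' + single j (d i)"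
  have w: "w \<in> exponents n" "weight d w = weight d u"
    using u u' j' by (auto simp: w_def exponents_single)
  have "i \<in> keys w" using less u' by (auto simp: w_def in_keys_iff lookup_add)
  then have "conn n d u w" using u w i by (auto intro: conn_share)
  moreover have "j \<in> keys w"
    using weights_pos[OF i'] by (simp add: w_def keys_add_nat)
  then have "conn n d w v" using v w j wt by (auto intro: conn_share)
  ultimately show False using assms(4) conn_trans by blast
qed

text \<open>Allows binomials to be prescribed as members of a star. Their weights must differ
  because a star has one root per weight: the second monomial of a prescribed pair becomes the root,
  the first one represents its class.\<close>

lemma star_extension:
  assumes P: "\<And>u v. (u, v) \<in> P \<Longrightarrow> u \<in> exponents n \<and> v \<in> exponents n \<and>
      weight d u = weight d v \<and> \<not> conn n d u v"
    and P_inj: "inj_on (weight d \<circ> fst) P"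
  obtains B where "star n d B" "P \<subseteq> B"
proof -
  define root where "root s = (if \<exists>p\<in>P. weight d (fst p) = s
    then snd (SOME p. p \<in> P \<and> weight d (fst p) = s)
    else (SOME u. u \<in> exponents n \<and> weight d u = s))" for s
  have root_P: "root (weight d u) = v" if "(u, v) \<in> P" for u v
  proof -
    have "(SOME p. p \<in> P \<and> weight d (fst p) = weight d u) = (u, v)"
      using that P_inj by (intro some_equality) (auto simp: inj_on_def)
    with that show ?thesis by (auto simp: root_def)
  qed
  have root: "root (weight d u) \<in> exponents n \<and> weight d (root (weight d u)) = weight d u"
    if u: "u \<in> exponents n" for u
  proof (cases "\<exists>p\<in>P. weight d (fst p) = weight d u")
    case True
    then obtain x y where xy: "(x, y) \<in> P" "weight d x = weight d u" by auto
    with P[OF xy(1)] root_P[OF xy(1)] show ?thesis by auto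
  next
    case False
    then have "root (weight d u) = (SOME v. v \<in> exponents n \<and> weight d v = weight d u)"
      by (simp add: root_def)
    with u show ?thesis
      using someI[of "\<lambda>v. v \<in> exponents n \<and> weight d v = weight d u" u] by simp
  qed
  \<comment> \<open>These monomials have to represent their own classes. No class contains two of
    them, because prescribed pairs have different weights and join different classes.\<close>
  define pref where "pref = {x. x \<in> fst ` P \<or> (x \<in> exponents n \<and> x = root (weight d x))}"
  have pref_unique: "x = y" if xy: "x \<in> pref" "y \<in> pref" "conn n d x y" for x y
  proof -
    have wt: "weight d x = weight d y" using conn_weight[OF xy(3)] .
    have mixed: False if "x \<in> fst ` P" "y = root (weight d y)" "conn n d x y" for x y
    proof -
      from that obtain z where "(x, z) \<in> P" by auto
      with root_P[OF this] P[OF this] that(2,3) conn_weight[OF that(3)] show False by simp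
    qed
    consider "x \<in> fst ` P" "y \<in> fst ` P" | "x = root (weight d x)" "y = root (weight d y)"
      using xy mixed[of x y] mixed[of y x] conn_sym[OF xy(3)] unfolding pref_def by blast
    then show ?thesis
    proof cases
      case 1
      then obtain x' y' where "(x, x') \<in> P" "(y, y') \<in> P" by auto
      with wt inj_onD[OF P_inj, of "(x, x')" "(y, y')"] show ?thesis by simp
    qed (simp add: wt)
  qed
  define rep where "rep u = (if \<exists>p\<in>pref. conn n d u p then SOME p. p \<in> pref \<and> conn n d u p
    else SOME p. conn n d u p)" for u
  have rep_conn: "conn n d u (rep u)" for u
  proof (cases "\<exists>p\<in>pref. conn n d u p")
    case True
    then have "rep u = (SOME p. p \<in> pref \<and> conn n d u p)" by (simp add: rep_def)
    with True show ?thesis using someI_ex[of "\<lambda>p. p \<in> pref \<and> conn n d u p"] by auto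
  next
    case False
    then have "rep u = (SOME p. conn n d u p)" by (simp add: rep_def)
    then show ?thesis using someI[of "conn n d u" u] conn_refl by simp
  qed
  have rep_eq: "rep u = rep v" if "conn n d u v" for u v
    unfolding rep_def conn_class_eq[OF that] ..
  have rep_pref: "rep u = u" if "u \<in> pref" for u
  proof -
    have "(SOME p. p \<in> pref \<and> conn n d u p) = u"
      using that pref_unique by (intro some_equality) (auto intro: conn_refl)
    with that show ?thesis by (auto simp: rep_def intro: conn_refl)
  qed
  have root_pref: "root (weight d u) \<in> pref" if "u \<in> exponents n" for u
    using root[OF that] by (simp add: pref_def)
  define B where "B = {(rep u, root (weight d u)) | u. u \<in> exponents n \<and> rep u \<noteq> root (weight d u)}"
  have BD: "u \<in> exponents n \<and> root (weight d u) = v \<and> rep u = u \<and> u \<noteq> v" if "(u, v) \<in> B" for u v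
  proof -
    from that obtain x where x: "x \<in> exponents n" "u = rep x" "v = root (weight d x)" "u \<noteq> v"
      unfolding B_def by blast
    then have "conn n d x u" using rep_conn by simp
    with x show ?thesis
      using rep_eq[of x u] conn_weight[of n d x u] conn_exponents[of n d x u] by simp
  qed
  have B_not_conn: "\<not> conn n d u v" if "(u, v) \<in> B" for u v
    using BD[OF that] rep_eq[of u v] rep_pref[OF root_pref, of u] by auto
  have B_weight: "v \<in> exponents n \<and> weight d u = weight d v" if "(u, v) \<in> B" for u v
    using BD[OF that] root[of u] by simp
  have linked: "\<forall>u\<in>exponents n. \<forall>v\<in>exponents n. weight d u = s \<longrightarrow> weight d v = s \<longrightarrow> linked n B u v"
    for s
  proof (induction s rule: less_induct)
    case (less s)
    \<comment> \<open>Cancelling a common variable \<open>x_i\<close> lowers the weight by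
      \<open>d i > 0\<close>, so the induction hypothesis links the quotients. Pairs of
      \<open>B\<close> of weight \<open>s\<close> serve only to join different classes.\<close>
    have conn_linked: "u \<in> exponents n \<and> weight d u = s \<longrightarrow> linked n B u v" if "conn n d u v" for u v
      using that
    proof (induction rule: conn.induct)
      case (conn_share u v i)
      show ?case
      proof
        assume u: "u \<in> exponents n \<and> weight d u = s"
        have pos: "1 \<le> lookup u i" "1 \<le> lookup v i" using conn_share by (auto simp: in_keys_iff)
        obtain u' where u': "u = u' + single i 1" by (rule exponent_split[OF pos(1)])
        obtain v' where v': "v = v' + single i 1" by (rule exponent_split[OF pos(2)])
        note uv' = u' v'
        have i: "i \<in> {1..n}" using conn_share exponents_keysD by blast
        then have "d i > 0" by (rule weights_pos)
        then have "weight d u' < s" using u uv' by simp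
        then have "linked n B u' v'"
          using less.IH conn_share uv' by auto
        then show "linked n B u v"
          using linked_add[of n B u' v' "single i 1"] i
          by (simp add: uv' exponents_single add.commute)
      qed
    next
      case (conn_refl u)
      show ?case by (simp add: linked_refl)
    next
      case (conn_sym u v)
      then show ?case
        using conn_weight[OF conn_sym.hyps] conn_exponents[OF conn_sym.hyps]
        by (auto intro: linked_sym)
    next
      case (conn_trans u v w)
      then show ?case
        using conn_weight[OF conn_trans.hyps(1)] conn_exponents[OF conn_trans.hyps(1)]
        by (auto intro: linked_trans)
    qed
    have to_root: "linked n B u (root s)" if u: "u \<in> exponents n" "weight d u = s" for u
    proof -
      have "linked n B u (rep u)" using conn_linked[OF rep_conn[of u]] u by blast
      moreover have "linked n B (rep u) (root s)"
      proof (cases "rep u = root s")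
        case False
        then have "(rep u, root s) \<in> B" using u by (auto simp: B_def)
        from linked_move[OF this, of 0 n] show ?thesis by simp
      qed (simp add: linked_refl)
      ultimately show ?thesis by (rule linked_trans)
    qed
    show ?case
    proof (intro ballI impI)
      fix u v assume "u \<in> exponents n" "v \<in> exponents n" "weight d u = s" "weight d v = s"
      then show "linked n B u v"
        using linked_trans[OF to_root[of u] linked_sym[OF to_root[of v]]] by blast
    qed
  qed
  have "presents n d B"
    unfolding presents_def
  proof (intro conjI ballI impI)
    fix b assume b: "b \<in> B"
    obtain u v where uv: "b = (u, v)" by (cases b)
    with b have "u \<in> exponents n \<and> v \<in> exponents n \<and> weight d u = weight d v"
      using BD[of u v] B_weight[of u v] by blast
    then show "case b of (u, v) \<Rightarrow> u \<in> exponents n \<and> v \<in> exponents n \<and> weight d u = weight d v"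
      by (simp add: uv)
  qed (use linked in blast)
  moreover have "finite B"
  proof (rule finite_subset)
    let ?S = "{u \<in> exponents n. \<forall>i. lookup u i \<le> (\<Sum>j\<in>{1..n}. d j)}"
    show "B \<subseteq> ?S \<times> ?S"
    proof
      fix b assume "b \<in> B"
      then obtain u v where b: "b = (u, v)" "(u, v) \<in> B" by (cases b) auto
      have nc: "\<not> conn n d v u" using B_not_conn[OF b(2)] conn_sym by blast
      have uv: "u \<in> exponents n" "v \<in> exponents n" "weight d u = weight d v"
        using BD[OF b(2)] B_weight[OF b(2)] by blast+
      show "b \<in> ?S \<times> ?S"
        using not_conn_bounded[OF uv B_not_conn[OF b(2)]]
          not_conn_bounded[OF uv(2,1) uv(3)[symmetric] nc] uv(1,2) b(1) by blast
    qed
    show "finite (?S \<times> ?S)" using finite_bounded_exponents by blast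
  qed
  moreover have "\<not> conn n d u v'" if "(u, v) \<in> B" "(u', v') \<in> B" for u v u' v'
  proof
    assume "conn n d u v'"
    then have "weight d u = weight d u'"
      using conn_weight B_weight[OF that(2)] by metis
    then have "v' = v" using BD[OF that(1)] BD[OF that(2)] by simp
    with \<open>conn n d u v'\<close> B_not_conn[OF that(1)] show False by simp
  qed
  moreover have "(u, v) = (u', v')" if "(u, v) \<in> B" "(u', v') \<in> B" "conn n d u u'" for u v u' v'
  proof -
    have "u = u'" using BD[OF that(1)] BD[OF that(2)] rep_eq[OF that(3)] by metis
    with BD[OF that(1)] BD[OF that(2)] show ?thesis by blast
  qed
  ultimately have "star n d B"
    unfolding star_def by fast
  moreover have "P \<subseteq> B"
  proof
    fix b assume "b \<in> P"
    then obtain u v where b: "b = (u, v)" "(u, v) \<in> P" by (cases b) auto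
    have "u \<in> pref" using b(2) by (force simp: pref_def)
    then have "rep u = u" by (rule rep_pref)
    moreover have "u \<noteq> v" using P[OF b(2)] conn_refl by auto
    ultimately show "b \<in> B"
      using P[OF b(2)] root_P[OF b(2)] b(1) unfolding B_def by force
  qed
  ultimately show ?thesis using that by blast
qed

end

section \<open>Minimal generators of toric ideals\<close>

definition binomial_poly :: "exponent \<times> exponent \<Rightarrow> 'k::field mpoly" where
  "binomial_poly b = single (fst b) 1 - single (snd b) 1"

definition weight_class :: "nat \<Rightarrow> (nat \<Rightarrow> nat) \<Rightarrow> nat \<Rightarrow> exponent set" where
  "weight_class n d s = {u \<in> exponents n. weight d u = s}"

definition coeff_sum :: "exponent set \<Rightarrow> 'k::field mpoly \<Rightarrow> 'k" where
  "coeff_sum K f = (\<Sum>m\<in>K. lookup f m)"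

section \<open>The polynomial ring and sums of coefficients\<close>

lemma mpoly_ring_simps [simp]:
  "carrier (mpoly_ring n) = {p. keys p \<subseteq> exponents n}"
  "x \<oplus>\<^bsub>mpoly_ring n\<^esub> y = x + y" "x \<otimes>\<^bsub>mpoly_ring n\<^esub> y = x * y"
  "\<zero>\<^bsub>mpoly_ring n\<^esub> = 0" "\<one>\<^bsub>mpoly_ring n\<^esub> = 1"
  by (auto simp: mpoly_ring_def ring_of_type_algebra_def exponents_def)

lemma cring_mpoly_ring: "cring (mpoly_ring n :: 'k::field mpoly ring)"
proof (rule cringI)
  show "abelian_group (mpoly_ring n :: 'k mpoly ring)"
  proof (rule abelian_groupI)
    fix x :: "'k mpoly" assume "x \<in> carrier (mpoly_ring n)"
    then have "-x \<in> carrier (mpoly_ring n)"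
      by (auto simp: in_keys_iff subset_iff)
    then show "\<exists>y\<in>carrier (mpoly_ring n). y \<oplus>\<^bsub>mpoly_ring n\<^esub> x = \<zero>\<^bsub>mpoly_ring n\<^esub>"
      by (intro bexI[of _ "-x"]) auto
  qed (use keys_add in \<open>fastforce simp: add_ac\<close>)+
  show "comm_monoid (mpoly_ring n :: 'k mpoly ring)"
  proof (rule comm_monoidI)
    fix x y :: "'k mpoly"
    assume "x \<in> carrier (mpoly_ring n)" "y \<in> carrier (mpoly_ring n)"
    then show "x \<otimes>\<^bsub>mpoly_ring n\<^esub> y \<in> carrier (mpoly_ring n)"
      using keys_mult[of x y] by fastforce
  qed (auto simp: mult_ac)
qed (auto simp: distrib_right)

lemma ideal_sum:
  assumes "ideal J (mpoly_ring n)" "finite A" "\<And>a. a \<in> A \<Longrightarrow> h a \<in> J"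
  shows "sum h A \<in> J"
proof -
  interpret ideal J "mpoly_ring n" by fact
  from assms(2,3) show ?thesis
    using additive_subgroup.zero_closed[OF is_additive_subgroup]
      additive_subgroup.a_closed[OF is_additive_subgroup]
    by (induction A rule: finite_induct) auto
qed

lemma poly_mapping_sum_single: "(\<Sum>u\<in>keys f. single u (lookup f u)) = f"
  by (rule poly_mapping_eqI)
    (auto simp: lookup_sum lookup_single when_def in_keys_iff sum.delta)

lemma mpoly_mult_expand:
  "f * g = (\<Sum>u\<in>keys f. \<Sum>v\<in>keys g. single (u + v) (lookup f u * lookup g v))"
  for f g :: "'k::field mpoly"
  by (subst (1) poly_mapping_sum_single[of f, symmetric],
      subst (1) poly_mapping_sum_single[of g, symmetric])
    (simp add: sum_product mult_single)

lemma sum_fun_apply: "(\<Sum>a\<in>A. h a) x = (\<Sum>a\<in>A. h a x)"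
  for h :: "'a \<Rightarrow> 'b \<Rightarrow> 'c::comm_monoid_add"
  by (induction A rule: infinite_finite_induct) auto

lemma coeff_sum_zero [simp]: "coeff_sum K 0 = 0"
  by (simp add: coeff_sum_def)

lemma coeff_sum_add: "coeff_sum K (f + g) = coeff_sum K f + coeff_sum K g"
  by (simp add: coeff_sum_def lookup_add sum.distrib)

lemma coeff_sum_diff: "coeff_sum K (f - g) = coeff_sum K f - coeff_sum K g"
  by (simp add: coeff_sum_def lookup_minus sum_subtractf)

lemma coeff_sum_sum: "coeff_sum K (sum h A) = (\<Sum>a\<in>A. coeff_sum K (h a))"
  unfolding coeff_sum_def lookup_sum by (rule sum.swap)

lemma coeff_sum_single: "finite K \<Longrightarrow> coeff_sum K (single m c) = (if m \<in> K then c else 0)"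
  by (simp add: coeff_sum_def lookup_single when_def)

lemma coeff_sum_keys:
  assumes "finite K"
  shows "coeff_sum K f = (\<Sum>m\<in>keys f. if m \<in> K then lookup f m else 0)"
proof -
  have "coeff_sum K f = coeff_sum K (\<Sum>m\<in>keys f. single m (lookup f m))"
    by (simp add: poly_mapping_sum_single)
  then show ?thesis
    by (simp add: coeff_sum_sum coeff_sum_single assms)
qed

lemma prod_monom_weight:
  "(\<Prod>i\<in>keys m. Polynomial.monom 1 (d i) ^ lookup m i) =
    (Polynomial.monom 1 (weight d m) :: 'k::field poly)"
proof -
  have "(\<Prod>i\<in>A. Polynomial.monom 1 (d i) ^ lookup m i) =
      (Polynomial.monom 1 (\<Sum>i\<in>A. lookup m i * d i) :: 'k poly)" if "finite A" for A
    using that by (induction A rule: finite_induct)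
      (simp_all add: monom_power mult_monom mult.commute one_poly_eq_simps(1) monom_eq_1)
  then show ?thesis by (simp add: weight_def)
qed

section \<open>The toric ideal through coefficient sums\<close>

context positive_weights
begin

lemma finite_weight_class: "finite (weight_class n d s)"
  by (rule finite_subset[OF _ finite_weight_exponents[of s]]) (auto simp: weight_class_def)

lemma coeff_toric_map:
  assumes "keys f \<subseteq> exponents n"
  shows "Polynomial.coeff (toric_map d f) s = coeff_sum (weight_class n d s) f"
proof -
  have "Polynomial.coeff (toric_map d f) s =
      (\<Sum>m\<in>keys f. if weight d m = s then lookup f m else 0)"
    unfolding toric_map_def prod_monom_weight
    by (simp add: coeff_sum if_distrib cong: if_cong)
  also have "\<dots> = (\<Sum>m\<in>keys f. if m \<in> weight_class n d s then lookup f m else 0)"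
    using assms by (intro sum.cong) (auto simp: weight_class_def)
  finally show ?thesis by (simp add: coeff_sum_keys finite_weight_class)
qed

text \<open>Replaces the homomorphism by one linear condition for each weight.\<close>

lemma mem_toric_ideal:
  "f \<in> toric_ideal n d \<longleftrightarrow> keys f \<subseteq> exponents n \<and> (\<forall>s. coeff_sum (weight_class n d s) f = 0)"
proof -
  have "f \<in> toric_ideal n d \<longleftrightarrow> keys f \<subseteq> exponents n \<and> toric_map d f = 0"
    unfolding toric_ideal_def a_kernel_def' by (simp add: ring_of_type_algebra_def)
  then show ?thesis
    using coeff_toric_map by (auto simp: poly_eq_iff)
qed

text \<open>The coefficient sums over the classes of linked monomials are functionals on the toric
  ideal \<open>I\<close> that vanish on \<open>\<mm>I\<close>; they bound the number of generators from below.\<close>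
lemma coeff_sum_mult:
  assumes f: "keys f \<subseteq> exponents n" and g: "g \<in> toric_ideal n d"
    and K: "K \<subseteq> weight_class n d s"
    and sat: "\<And>u v i. u \<in> K \<Longrightarrow> v \<in> weight_class n d s \<Longrightarrow> i \<in> keys u \<Longrightarrow> i \<in> keys v \<Longrightarrow> v \<in> K"
  shows "coeff_sum K (f * g) = lookup f 0 * coeff_sum K g"
proof -
  have fin: "finite K" using K finite_weight_class finite_subset by blast
  have g_exp: "keys g \<subseteq> exponents n" using g by (simp add: mem_toric_ideal)
  have K_weight: "weight d x = s" if "x \<in> K" for x
    using K that by (auto simp: weight_class_def)
  \<comment> \<open>For nonzero \<open>u\<close>, saturation of \<open>K\<close> makes the monomials
    of \<open>g\<close> counted here either none at all or all those of one weight, and over these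
    the coefficients of \<open>g\<close> sum to 0.\<close>
  define inner where "inner u = (\<Sum>v\<in>keys g. if u + v \<in> K then lookup g v else 0)" for u
  have "coeff_sum K (f * g) = (\<Sum>u\<in>keys f. lookup f u * inner u)"
    unfolding mpoly_mult_expand coeff_sum_sum inner_def sum_distrib_left
    by (intro sum.cong) (auto simp: coeff_sum_single fin)
  also have "\<dots> = (\<Sum>u\<in>keys f. if u = 0 then lookup f 0 * coeff_sum K g else 0)"
  proof (intro sum.cong refl)
    fix u assume u: "u \<in> keys f"
    show "lookup f u * inner u = (if u = 0 then lookup f 0 * coeff_sum K g else 0)"
    proof (cases "u = 0")
      case True
      then show ?thesis by (simp add: inner_def coeff_sum_keys fin)
    next
      case False
      then obtain i where i: "i \<in> keys u" by (auto simp: poly_mapping_eq_iff fun_eq_iff in_keys_iff)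
      have "inner u = 0"
      proof (cases "\<exists>v\<in>keys g. u + v \<in> K")
        case True
        then obtain v where v: "v \<in> keys g" "u + v \<in> K" by blast
        have "u + w \<in> K \<longleftrightarrow> w \<in> weight_class n d (weight d v)" if "w \<in> keys g" for w
        proof
          assume "u + w \<in> K"
          then show "w \<in> weight_class n d (weight d v)"
            using K_weight[OF v(2)] K_weight[OF \<open>u + w \<in> K\<close>] g_exp that
            by (auto simp: weight_class_def)
        next
          assume "w \<in> weight_class n d (weight d v)"
          then have "u + w \<in> weight_class n d s"
            using v K by (auto simp: weight_class_def)
          with sat[OF v(2), of "u + w" i] i show "u + w \<in> K" by (simp add: keys_add_nat)
        qed
        then have "inner u = coeff_sum (weight_class n d (weight d v)) g"
          unfolding inner_def coeff_sum_keys[OF finite_weight_class]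
          by (intro sum.cong) auto
        with g show ?thesis by (simp add: mem_toric_ideal)
      qed (simp add: inner_def)
      with False show ?thesis by simp
    qed
  qed
  also have "\<dots> = lookup f 0 * coeff_sum K g"
    by (auto simp: in_keys_iff)
  finally show ?thesis .
qed

definition conn_class :: "exponent \<Rightarrow> exponent set" where
  "conn_class u = {v. conn n d u v}"

lemma conn_class_subset: "u \<in> exponents n \<Longrightarrow> conn_class u \<subseteq> weight_class n d (weight d u)"
  by (auto simp: conn_class_def weight_class_def dest: conn_weight conn_exponents)

lemma coeff_sum_conn_class_mult:
  assumes "keys f \<subseteq> exponents n" "g \<in> toric_ideal n d" "u \<in> exponents n"
  shows "coeff_sum (conn_class u) (f * g) = lookup f 0 * coeff_sum (conn_class u) g"
proof (rule coeff_sum_mult[OF assms(1,2) conn_class_subset[OF assms(3)]])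
  fix x y i
  assume xy: "x \<in> conn_class u" "y \<in> weight_class n d (weight d u)" "i \<in> keys x" "i \<in> keys y"
  then have "conn n d u x" by (simp add: conn_class_def)
  then have "conn n d x y"
    using xy assms(3) conn_weight[of n d u x] conn_exponents[of n d u x]
    by (auto simp: weight_class_def intro: conn_share)
  then show "y \<in> conn_class u"
    using \<open>conn n d u x\<close> by (auto simp: conn_class_def intro: conn_trans)
qed

text \<open>Multiplication by \<open>f\<close> acts on the values of \<open>\<Phi>\<close> through
  the constant coefficient of \<open>f\<close> alone, so it is enough that \<open>S\<close> is
  closed under addition and scaling. The zero map gives the toric ideal itself, and coefficient sums
  over classes give the lower bound on generators.\<close>

lemma ideal_toric_vimage:
  fixes \<Phi> :: "'k::field mpoly \<Rightarrow> 'b \<Rightarrow> 'k"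
  assumes add: "\<And>f g. \<Phi> (f + g) = \<Phi> f + \<Phi> g"
    and mult: "\<And>f g. keys f \<subseteq> exponents n \<Longrightarrow> g \<in> toric_ideal n d \<Longrightarrow>
        \<Phi> (f * g) = (\<lambda>b. lookup f 0 * \<Phi> g b)"
    and S0: "0 \<in> S" and S_add: "\<And>x y. x \<in> S \<Longrightarrow> y \<in> S \<Longrightarrow> x + y \<in> S"
    and S_scale: "\<And>c x. x \<in> S \<Longrightarrow> (\<lambda>b. c * x b) \<in> S"
  shows "ideal {f \<in> toric_ideal n d. \<Phi> f \<in> S} (mpoly_ring n)"
proof -
  let ?R = "mpoly_ring n :: 'k mpoly ring"
  interpret R: cring ?R by (rule cring_mpoly_ring)
  have I_mult: "f * g \<in> toric_ideal n d" if f: "keys f \<subseteq> exponents n" and g: "g \<in> toric_ideal n d"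
    for f g :: "'k mpoly"
  proof -
    have "keys (f * g) \<subseteq> exponents n"
      using R.m_closed[of f g] f g by (simp add: mem_toric_ideal)
    moreover have "coeff_sum (weight_class n d s) (f * g) = 0" for s
      using coeff_sum_mult[OF f g order_refl, of s] g by (simp add: mem_toric_ideal)
    ultimately show ?thesis by (simp add: mem_toric_ideal)
  qed
  have I_add: "f + g \<in> toric_ideal n d" if "f \<in> toric_ideal n d" "g \<in> toric_ideal n d"
    for f g :: "'k mpoly"
    using that R.a_closed[of f g] by (auto simp: mem_toric_ideal coeff_sum_add)
  have \<Phi>0: "\<Phi> 0 = 0" using add[of 0 0] by simp
  have uminus: "- f = single 0 (-1) * f" for f :: "'k mpoly"
    by (simp add: single_uminus)
  show ?thesis
  proof (rule idealI)
    show "ring ?R" by (rule R.ring_axioms)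
    show "subgroup {f \<in> toric_ideal n d. \<Phi> f \<in> S} (add_monoid ?R)"
    proof (rule group.subgroupI)
      show "group (add_monoid ?R)" by (rule R.a_group)
      have "0 \<in> {f \<in> toric_ideal n d. \<Phi> f \<in> S}"
        using S0 \<Phi>0 by (simp add: mem_toric_ideal)
      then show "{f \<in> toric_ideal n d. \<Phi> f \<in> S} \<noteq> {}" by blast
      fix a assume a: "a \<in> {f \<in> toric_ideal n d. \<Phi> f \<in> S}"
      then have a_carr: "a \<in> carrier ?R" by (simp add: mem_toric_ideal)
      have "- a \<in> {f \<in> toric_ideal n d. \<Phi> f \<in> S}"
        unfolding uminus[of a]
        using a I_mult[of "single 0 (-1)" a] mult[of "single 0 (-1)" a] S_scale[of _ "-1"] by simp
      moreover have "inv\<^bsub>add_monoid ?R\<^esub> a = - a"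
      proof -
        have "\<ominus>\<^bsub>?R\<^esub> a = - a"
          using R.minus_equality[of "- a" a] a_carr by (simp add: in_keys_iff subset_iff)
        then show ?thesis by (simp add: a_inv_def)
      qed
      ultimately show "inv\<^bsub>add_monoid ?R\<^esub> a \<in> {f \<in> toric_ideal n d. \<Phi> f \<in> S}" by simp
    qed (auto simp: mem_toric_ideal add I_add S_add coeff_sum_add dest: subsetD[OF keys_add])
  next
    fix a x assume "a \<in> {f \<in> toric_ideal n d. \<Phi> f \<in> S}" "x \<in> carrier ?R"
    then show "x \<otimes>\<^bsub>?R\<^esub> a \<in> {f \<in> toric_ideal n d. \<Phi> f \<in> S}"
      and "a \<otimes>\<^bsub>?R\<^esub> x \<in> {f \<in> toric_ideal n d. \<Phi> f \<in> S}"
      using I_mult[of x a] mult[of x a] S_scale by (simp_all add: mult.commute)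
  qed
qed

lemma ideal_toric_ideal: "ideal (toric_ideal n d :: 'k::field mpoly set) (mpoly_ring n)"
  using ideal_toric_vimage[of "\<lambda>_. 0 :: unit \<Rightarrow> 'k" UNIV] by (simp add: zero_fun_def)

section \<open>Generation by binomials\<close>

lemma binomial_in_toric_ideal:
  assumes "u \<in> exponents n" "v \<in> exponents n" "weight d u = weight d v"
  shows "binomial_poly (u, v) \<in> toric_ideal n d"
proof -
  have "keys (binomial_poly (u, v)) \<subseteq> {u, v}"
    by (auto simp: binomial_poly_def in_keys_iff lookup_minus lookup_single when_def split: if_splits)
  moreover have "u \<in> weight_class n d s \<longleftrightarrow> v \<in> weight_class n d s" for s
    using assms by (simp add: weight_class_def)
  then have "coeff_sum (weight_class n d s) (binomial_poly (u, v)) = 0" for s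
    by (simp add: binomial_poly_def coeff_sum_diff coeff_sum_single finite_weight_class)
  ultimately show ?thesis
    using assms by (auto simp: mem_toric_ideal)
qed

lemma toric_ideal_carrier: "toric_ideal n d \<subseteq> carrier (mpoly_ring n)"
  by (auto simp: mem_toric_ideal)

lemma presentation_binomials:
  assumes "presents n d B"
  shows "binomial_poly ` B \<subseteq> toric_ideal n d"
proof clarify
  fix u v assume "(u, v) \<in> B"
  from presentsD[OF assms this] show "binomial_poly (u, v) \<in> toric_ideal n d"
    by (rule binomial_in_toric_ideal)
qed

text \<open>Modulo linked pairs every monomial may be replaced by one fixed monomial of its weight.
  What remains of \<open>f\<close> is zero, because its coefficients are the coefficient sums of
  \<open>f\<close> over weight classes.\<close>

lemma presentation_generates:
  assumes B: "presents n d B" "finite B"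
  shows "Idl\<^bsub>mpoly_ring n\<^esub> (binomial_poly ` B) = (toric_ideal n d :: 'k::field mpoly set)"
proof
  let ?R = "mpoly_ring n :: 'k mpoly ring"
  interpret R: cring ?R by (rule cring_mpoly_ring)
  have sub: "binomial_poly ` B \<subseteq> (toric_ideal n d :: 'k mpoly set)"
    by (rule presentation_binomials[OF B(1)])
  then show "Idl\<^bsub>?R\<^esub> (binomial_poly ` B) \<subseteq> toric_ideal n d"
    by (intro R.genideal_minimal ideal_toric_ideal)
  have carr: "binomial_poly ` B \<subseteq> carrier ?R"
    using sub toric_ideal_carrier by (rule order_trans)
  define J where "J = Idl\<^bsub>?R\<^esub> (binomial_poly ` B)"
  have J: "ideal J ?R" unfolding J_def by (rule R.genideal_ideal[OF carr])
  interpret J: ideal J ?R by (rule J)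
  have J_mult: "f * g \<in> J" if "keys f \<subseteq> exponents n" "g \<in> J" for f g
    using J.I_l_closed[of g f] that by simp
  have linked_J: "binomial_poly (u, v) \<in> J" if "linked n B u v" for u v
    using that
  proof (induction rule: linked.induct)
    case (linked_move u v w)
    have "binomial_poly (u, v) \<in> J"
      unfolding J_def using R.genideal_self[OF carr] linked_move(1) by blast
    then have "single w 1 * binomial_poly (u, v) \<in> J"
      by (rule J_mult[rotated]) (use linked_move in simp)
    then show ?case
      by (simp add: binomial_poly_def right_diff_distrib mult_single)
  next
    case (linked_refl u)
    then show ?case
      using additive_subgroup.zero_closed[OF J.is_additive_subgroup] by (simp add: binomial_poly_def)
  next
    case (linked_sym u v)
    then have "single 0 (-1) * binomial_poly (u, v) \<in> J" by (intro J_mult) auto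
    then show ?case by (simp add: binomial_poly_def right_diff_distrib mult_single single_uminus)
  next
    case (linked_trans u v w)
    then have "binomial_poly (u, v) + binomial_poly (v, w) \<in> J"
      using additive_subgroup.a_closed[OF J.is_additive_subgroup] by simp
    then show ?case by (simp add: binomial_poly_def)
  qed
  show "toric_ideal n d \<subseteq> Idl\<^bsub>?R\<^esub> (binomial_poly ` B)"
  proof
    fix f :: "'k mpoly" assume f: "f \<in> toric_ideal n d"
    then have f_exp: "keys f \<subseteq> exponents n" by (simp add: mem_toric_ideal)
    \<comment> \<open>An arbitrary monomial of weight \<open>s\<close>, meaningful for the weights
      that occur in \<open>f\<close>.\<close>
    define \<rho> where "\<rho> s = (SOME u. u \<in> weight_class n d s)" for s
    have \<rho>: "\<rho> (weight d u) \<in> weight_class n d (weight d u)" if "u \<in> keys f" for u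
      unfolding \<rho>_def by (rule someI[of _ u]) (use that f_exp in \<open>auto simp: weight_class_def\<close>)
    have zero: "(\<Sum>u\<in>keys f. single (\<rho> (weight d u)) (lookup f u)) = 0"
    proof (rule poly_mapping_eqI)
      fix m
      have "lookup (\<Sum>u\<in>keys f. single (\<rho> (weight d u)) (lookup f u)) m =
          (\<Sum>u\<in>keys f. if \<rho> (weight d u) = m then lookup f u else 0)"
        by (simp add: lookup_sum lookup_single when_def)
      also have "\<dots> = 0"
      proof (cases "\<exists>v\<in>keys f. \<rho> (weight d v) = m")
        case True
        then obtain v where v: "v \<in> keys f" "\<rho> (weight d v) = m" by blast
        have m: "weight d m = weight d v" using \<rho>[OF v(1)] v(2) by (simp add: weight_class_def)
        have "\<rho> (weight d u) = m \<longleftrightarrow> u \<in> weight_class n d (weight d v)" if "u \<in> keys f" for u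
          using \<rho>[OF that] v m that f_exp by (auto simp: weight_class_def)
        then have "(\<Sum>u\<in>keys f. if \<rho> (weight d u) = m then lookup f u else 0) =
            coeff_sum (weight_class n d (weight d v)) f"
          unfolding coeff_sum_keys[OF finite_weight_class] by (intro sum.cong) auto
        with f show ?thesis by (simp add: mem_toric_ideal)
      next
        case False
        then show ?thesis by (intro sum.neutral) auto
      qed
      finally show "lookup (\<Sum>u\<in>keys f. single (\<rho> (weight d u)) (lookup f u)) m = lookup 0 m"
        by simp
    qed
    have "(\<Sum>u\<in>keys f. single 0 (lookup f u) * binomial_poly (u, \<rho> (weight d u))) \<in> J"
    proof (intro ideal_sum[OF J] finite_keys J_mult)
      fix u assume "u \<in> keys f"
      then show "binomial_poly (u, \<rho> (weight d u)) \<in> J"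
        using \<rho>[of u] f_exp
        by (intro linked_J presents_linked[OF B(1)]) (auto simp: weight_class_def)
    qed (simp add: keys_single)
    also have "(\<Sum>u\<in>keys f. single 0 (lookup f u) * binomial_poly (u, \<rho> (weight d u))) =
        (\<Sum>u\<in>keys f. single u (lookup f u)) -
        (\<Sum>u\<in>keys f. single (\<rho> (weight d u)) (lookup f u))"
      by (simp add: binomial_poly_def right_diff_distrib mult_single sum_subtractf)
    also have "\<dots> = f"
      by (simp add: zero poly_mapping_sum_single)
    finally show "f \<in> Idl\<^bsub>?R\<^esub> (binomial_poly ` B)" by (simp add: J_def)
  qed
qed

text \<open>Each pair of the star is sent to a unit vector: its first monomial lies in no other
  class that is used, its second one, a root, in none of them. All images of the toric ideal lie in
  the span of the images of \<open>G\<close>, so linear independence bounds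
  \<open>card B\<close>.\<close>

lemma star_card_le:
  fixes G :: "'k::field mpoly set"
  assumes B: "star n d B" and G: "finite G" "G \<subseteq> carrier (mpoly_ring n)"
    and gen: "Idl\<^bsub>mpoly_ring n\<^esub> G = toric_ideal n d"
  shows "card B \<le> card G"
proof -
  let ?R = "mpoly_ring n :: 'k mpoly ring"
  interpret R: cring ?R by (rule cring_mpoly_ring)
  interpret V: vector_space "\<lambda>c (x :: exponent \<times> exponent \<Rightarrow> 'k) b. c * x b"
    by unfold_locales (auto simp: fun_eq_iff distrib_left distrib_right mult.assoc)
  have fin: "finite B" and pres: "presents n d B"
    and indep: "\<And>u v u' v'. (u, v) \<in> B \<Longrightarrow> (u', v') \<in> B \<Longrightarrow>
      \<not> conn n d u v' \<and> (conn n d u u' \<longrightarrow> (u, v) = (u', v'))"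
    using B unfolding star_def by auto
  \<comment> \<open>Coordinates are indexed by all pairs of exponents, with 0 outside
    \<open>B\<close>, so that the values live in one function space.\<close>
  define \<Phi> where "\<Phi> f b = (if b \<in> B then coeff_sum (conn_class (fst b)) f else 0)"
    for f :: "'k mpoly" and b
  define S where "S = V.span (\<Phi> ` G)"
  have "ideal {f \<in> toric_ideal n d. \<Phi> f \<in> S} ?R"
  proof (rule ideal_toric_vimage)
    show "\<Phi> (f + g) = \<Phi> f + \<Phi> g" for f g
      by (auto simp: \<Phi>_def coeff_sum_add)
    show "\<Phi> (f * g) = (\<lambda>b. lookup f 0 * \<Phi> g b)"
      if "keys f \<subseteq> exponents n" "g \<in> toric_ideal n d" for f g
      using that presentsD(1)[OF pres] by (auto simp: \<Phi>_def coeff_sum_conn_class_mult)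
  qed (auto simp: S_def V.span_zero V.span_add V.span_scale)
  moreover have "G \<subseteq> {f \<in> toric_ideal n d. \<Phi> f \<in> S}"
    using R.genideal_self[OF G(2)] gen by (auto simp: S_def V.span_base)
  ultimately have span: "toric_ideal n d \<subseteq> {f \<in> toric_ideal n d. \<Phi> f \<in> S}"
    unfolding gen[symmetric] by (rule R.genideal_minimal)
  define e where "e b = (\<lambda>b'. if b' = b then 1 else 0 :: 'k)" for b :: "exponent \<times> exponent"
  have e: "\<Phi> (binomial_poly b) = e b" if b: "b \<in> B" for b
  proof
    fix b' :: "exponent \<times> exponent"
    obtain u v u' v' where [simp]: "b = (u, v)" "b' = (u', v')" by (cases b, cases b')
    show "\<Phi> (binomial_poly b) b' = e b b'"
    proof (cases "b' \<in> B")
      case True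
      have "finite (conn_class u')"
        using finite_subset[OF conn_class_subset finite_weight_class] presentsD(1)[OF pres] True
        by simp
      then have "\<Phi> (binomial_poly b) b' =
          (if u \<in> conn_class u' then 1 else 0) - (if v \<in> conn_class u' then 1 else 0)"
        using True by (simp add: \<Phi>_def binomial_poly_def coeff_sum_diff coeff_sum_single)
      moreover have "v \<notin> conn_class u'"
        using indep[of u' v' u v] b True by (simp add: conn_class_def)
      moreover have "u \<in> conn_class u' \<longleftrightarrow> b' = b"
        using indep[of u' v' u v] b True by (auto simp: conn_class_def conn_refl)
      ultimately show ?thesis by (simp add: e_def)
    next
      case False
      with b show ?thesis by (auto simp: \<Phi>_def e_def)
    qed
  qed
  have inj: "inj_on e B"
    by (rule inj_onI) (metis e_def zero_neq_one)
  have "V.independent (e ` B)"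
  proof (rule V.independent_if_scalars_zero)
    show "finite (e ` B)" using fin by simp
    fix c x
    assume sum: "(\<Sum>x\<in>e ` B. (\<lambda>b. c x * x b)) = 0" and "x \<in> e ` B"
    then obtain b where b: "b \<in> B" "x = e b" by blast
    have "(\<Sum>x\<in>e ` B. (\<lambda>b. c x * x b)) b = (\<Sum>b'\<in>B. c (e b') * e b' b)"
      unfolding sum.reindex[OF inj] by (simp add: sum_fun_apply)
    also have "\<dots> = (\<Sum>b'\<in>B. if b' = b then c (e b) else 0)"
      by (intro sum.cong) (auto simp: e_def)
    finally show "c x = 0"
      using sum b fin by simp
  qed
  moreover have "e ` B \<subseteq> V.span (\<Phi> ` G)"
  proof
    fix x assume "x \<in> e ` B"
    then obtain b where b: "b \<in> B" "x = e b" by blast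
    then have "binomial_poly b \<in> (toric_ideal n d :: 'k mpoly set)"
      using binomial_in_toric_ideal[of "fst b" "snd b"] presentsD[OF pres, of "fst b" "snd b"] by simp
    with span have "\<Phi> (binomial_poly b) \<in> V.span (\<Phi> ` G)" by (auto simp: S_def)
    then show "x \<in> V.span (\<Phi> ` G)" by (simp only: e[OF b(1)] b(2))
  qed
  ultimately have "card (e ` B) \<le> card (\<Phi> ` G)"
    using V.independent_span_bound[of "\<Phi> ` G" "e ` B"] G(1) by simp
  then show ?thesis
    using card_image_le[OF G(1), of \<Phi>] card_image[OF inj] by simp
qed

section \<open>The minimal number of generators\<close>

lemma min_num_generators_le:
  assumes "presents n d B" "finite B"
  shows "min_num_generators (mpoly_ring n) (toric_ideal n d :: 'k::field mpoly set) \<le> card B"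
proof -
  let ?G = "binomial_poly ` B :: 'k mpoly set"
  have "?G \<subseteq> carrier (mpoly_ring n)"
    using presentation_binomials[OF assms(1)] toric_ideal_carrier by (rule order_trans)
  then have "min_num_generators (mpoly_ring n) (toric_ideal n d :: 'k mpoly set) \<le> card ?G"
    unfolding min_num_generators_def using presentation_generates[OF assms] assms(2)
    by (intro Least_le exI[of _ ?G]) auto
  also have "\<dots> \<le> card B" by (rule card_image_le[OF assms(2)])
  finally show ?thesis .
qed

lemma min_num_generators_star:
  assumes "star n d B"
  shows "min_num_generators (mpoly_ring n) (toric_ideal n d :: 'k::field mpoly set) = card B"
proof (rule antisym)
  have B: "presents n d B" "finite B" using assms by (auto simp: star_def)
  show "min_num_generators (mpoly_ring n) (toric_ideal n d :: 'k mpoly set) \<le> card B"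
    by (rule min_num_generators_le[OF B])
  have carr: "binomial_poly ` B \<subseteq> carrier (mpoly_ring n :: 'k mpoly ring)"
    using presentation_binomials[OF B(1)] toric_ideal_carrier by (rule order_trans)
  show "card B \<le> min_num_generators (mpoly_ring n) (toric_ideal n d :: 'k mpoly set)"
    unfolding min_num_generators_def
  proof (rule LeastI2_ex)
    show "\<exists>r G. G \<subseteq> carrier (mpoly_ring n) \<and> finite G \<and> card G = r \<and>
        Idl\<^bsub>mpoly_ring n\<^esub> G = (toric_ideal n d :: 'k mpoly set)"
      using carr presentation_generates[OF B] B(2) by blast
  qed (use star_card_le[OF assms, where 'k = 'k] in auto)
qed

lemma complete_intersection_star:
  assumes "star n d B"
  shows "toric_complete_intersection TYPE('k::field) n d \<longleftrightarrow> card B = n - 1"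
  by (simp add: toric_complete_intersection_def min_num_generators_star[OF assms])

text \<open>A presentation gives only the upper bound; a star attains the minimum and has at least
  \<open>n - 1\<close> pairs.\<close>

lemma complete_intersectionI:
  assumes "presents n d B" "finite B" "card B \<le> n - 1" "n \<ge> 1"
  shows "toric_complete_intersection TYPE('k::field) n d"
proof -
  obtain B' where B': "star n d B'"
    by (rule star_extension[of "{}"]) auto
  have "n - 1 \<le> card B'"
    using B' assms(4) by (intro card_presentation_ge) (auto simp: star_def)
  moreover have "card B' \<le> n - 1"
    using min_num_generators_star[OF B', where 'k = 'k] min_num_generators_le[OF assms(1,2), where 'k = 'k]
      assms(3) by simp
  ultimately show ?thesis by (simp add: complete_intersection_star[OF B'])
qed

lemma complete_intersection_dead:
  assumes ci: "toric_complete_intersection TYPE('k::field) n d" and B: "star n d B"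
    and C: "C \<subseteq> {1..n}" "C \<noteq> {}"
  shows "card (dead B C) < card C"
proof -
  have "n + card (dead B C) \<le> card C + card B"
    using B by (intro card_dead_bound C) (auto simp: star_def)
  moreover have "card B = n - 1" using ci complete_intersection_star[OF B, where 'k = 'k] by simp
  moreover have "n \<ge> 1" using C by (auto simp: Suc_le_eq)
  ultimately show ?thesis by linarith
qed

end

section \<open>Reduced families of three elements\<close>

lemma lin_combs_empty [simp]: "lin_combs {} = {0}"
  by (simp add: lin_combs_def)

lemma lin_combs_insert:
  assumes "finite B"
  shows "v \<in> lin_combs (insert b B) \<longleftrightarrow> (\<exists>x. \<exists>y\<in>lin_combs B. v = x * of_nat b + y)"
proof
  assume "v \<in> lin_combs (insert b B)"
  then obtain c where c: "v = (\<Sum>a\<in>insert b B. c a * of_nat a)" by (auto simp: lin_combs_def)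
  show "\<exists>x. \<exists>y\<in>lin_combs B. v = x * of_nat b + y"
  proof (cases "b \<in> B")
    case True
    then have "v \<in> lin_combs B" using c by (auto simp: lin_combs_def insert_absorb)
    then show ?thesis by (intro exI[of _ 0] bexI[of _ v]) auto
  next
    case False
    then show ?thesis
      using c assms by (intro exI[of _ "c b"] bexI[of _ "\<Sum>a\<in>B. c a * of_nat a"])
        (auto simp: lin_combs_def)
  qed
next
  assume "\<exists>x. \<exists>y\<in>lin_combs B. v = x * of_nat b + y"
  then obtain x c where v: "v = x * of_nat b + (\<Sum>a\<in>B. c a * of_nat a)"
    by (auto simp: lin_combs_def)
  define c' where "c' = c(b := x + (if b \<in> B then c b else 0))"
  have "(\<Sum>a\<in>insert b B. c' a * of_nat a) =
      c' b * of_nat b + (\<Sum>a\<in>B - {b}. c' a * of_nat a)"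
    using assms by (simp add: sum.insert_remove)
  also have "(\<Sum>a\<in>B - {b}. c' a * of_nat a) = (\<Sum>a\<in>B - {b}. c a * of_nat a)"
    by (intro sum.cong) (auto simp: c'_def)
  also have "c' b * of_nat b + \<dots> = v"
    using assms by (cases "b \<in> B") (simp_all add: v c'_def distrib_right sum.remove add_ac)
  finally show "v \<in> lin_combs (insert b B)" by (auto simp: lin_combs_def intro!: exI[of _ c'])
qed

lemma lin_combs_singleton: "v \<in> lin_combs {b} \<longleftrightarrow> (\<exists>x. v = x * of_nat b)"
  by (simp add: lin_combs_insert)

lemma lin_combs_nat2:
  "(t :: nat) \<in> lin_combs {y, z} \<longleftrightarrow> (\<exists>k l. t = k * y + l * z)"
  by (simp add: lin_combs_insert[of "{z}"] Bex_def lin_combs_singleton) blast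

lemma lin_combs_nat3:
  "(t :: nat) \<in> lin_combs {x, y, z} \<longleftrightarrow> (\<exists>j k l. t = j * x + k * y + l * z)"
  by (simp add: lin_combs_insert[of "{y, z}"] Bex_def lin_combs_nat2 add.assoc) blast

lemma lin_combs_int:
  assumes "finite B"
  shows "(v :: int) \<in> lin_combs B \<longleftrightarrow> int (Gcd B) dvd v"
  using assms
proof (induction B arbitrary: v rule: finite_induct)
  case (insert b B)
  let ?g = "int (Gcd B)"
  have "v \<in> lin_combs (insert b B) \<longleftrightarrow> (\<exists>x y. v = x * int b + y * ?g)"
    unfolding lin_combs_insert[OF insert.hyps(1)] Bex_def insert.IH
    by (auto simp: dvd_def) (metis mult.commute)+
  also have "\<dots> \<longleftrightarrow> gcd (int b) ?g dvd v"
  proof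
    assume "gcd (int b) ?g dvd v"
    then obtain k where k: "v = gcd (int b) ?g * k" by blast
    obtain x y where "x * int b + y * ?g = gcd (int b) ?g" using bezout_int by blast
    with k have "v = (k * x) * int b + (k * y) * ?g" by (simp add: algebra_simps flip: distrib_left)
    then show "\<exists>x y. v = x * int b + y * ?g" by blast
  qed auto
  finally show ?case by simp
qed simp

text \<open>Over the rationals one positive number spans everything, so only the last remaining
  member of a family can be independent.\<close>

lemma lin_combs_rat:
  assumes "finite B" "\<forall>b\<in>B. b > 0"
  shows "(v :: rat) \<in> lin_combs B \<longleftrightarrow> B \<noteq> {} \<or> v = 0"
proof (cases "B = {}")
  case False
  then obtain b where b: "b \<in> B" by blast
  have "0 \<in> (lin_combs B :: rat set)" by (auto simp: lin_combs_def intro!: exI[of _ "\<lambda>_. 0"])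
  then have "v \<in> lin_combs (insert b B)"
    using assms b unfolding lin_combs_insert[OF assms(1)]
    by (intro exI[of _ "v / of_nat b"] bexI[of _ 0]) auto
  with b False show ?thesis by (simp add: insert_absorb)
qed simp

text \<open>A multiple of \<open>b\<close> is an integer combination of \<open>R\<close> exactly if
  the gcd of \<open>R\<close> divides it, so the least positive one is a least common
  multiple.\<close>

lemma red_factor_mult:
  assumes "b > 0" "R \<noteq> {#}" "\<forall>r\<in>#R. r > 0"
  shows "red_factor b R * b = lcm b (Gcd (set_mset R))"
proof -
  define G where "G = Gcd (set_mset R)"
  obtain r where "r \<in># R" using assms(2) by blast
  then have "\<not> set_mset R \<subseteq> {0}" using assms(3) by force
  then have "G \<noteq> 0" by (simp add: G_def)
  then have "G > 0" by simp
  obtain k where k: "lcm b G = b * k" by (metis dvd_lcm1 dvdE)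
  have "k > 0" using k \<open>G > 0\<close> assms(1) by (metis lcm_pos_nat mult_0_right neq0_conv)
  have "red_factor b R = k"
    unfolding red_factor_def
  proof (rule Least_equality)
    show "k > 0 \<and> int (k * b) \<in> lin_combs (set_mset R)"
      using \<open>k > 0\<close> dvd_lcm2[of G b] k by (simp add: lin_combs_int G_def[symmetric] mult.commute
          flip: of_nat_mult)
    fix y assume "0 < y \<and> int (y * b) \<in> lin_combs (set_mset R)"
    then have y: "y > 0" "G dvd y * b" by (auto simp: lin_combs_int G_def simp flip: of_nat_mult)
    then have "lcm b G dvd y * b" by (simp add: lcm_least)
    then have "b * k \<le> y * b" using k y assms(1) by (auto intro: dvd_imp_le)
    then show "k \<le> y" using assms(1) by (simp add: mult.commute)
  qed
  with k show ?thesis by (simp add: G_def mult.commute)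
qed

text \<open>For positive members, the rational side conditions of the rules only tell whether other
  members exist.\<close>

lemma red_stepE:
  assumes "red_step M M'" "\<forall>x\<in>#M. x > 0"
  obtains (remove_last) b where "M = {#b#}" "M' = {#}"
  | (remove) b R where "R \<noteq> {#}" "M = add_mset b R" "b \<in> lin_combs (set_mset R)" "M' = R"
  | (multiply) b R where "R \<noteq> {#}" "M = add_mset b R" "M' = add_mset (lcm b (Gcd (set_mset R))) R"
  using assms
proof (cases rule: red_step.cases)
  case (remove_independent b)
  then show ?thesis using assms(2) that(1)[of b]
    by (auto simp: lin_combs_rat)
next
  case (remove_redundant b)
  then show ?thesis using assms(2) that(2)[of M' b] by (cases "M' = {#}") auto
next
  case (multiply b R)
  then show ?thesis using assms(2) that(3)[of R b] red_factor_mult[of b R]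
    by (cases "R = {#}") (auto simp: lin_combs_rat)
qed

lemma red_step_last: "b > 0 \<Longrightarrow> red_step {#b#} {#}"
  by (rule red_step.remove_independent) simp

lemma red_step_multiply:
  assumes "b > 0" "R \<noteq> {#}" "\<forall>r\<in>#R. r > 0" "lcm b (Gcd (set_mset R)) \<noteq> b"
  shows "red_step (add_mset b R) (add_mset (lcm b (Gcd (set_mset R))) R)"
  using red_step.multiply[of b R] assms red_factor_mult[OF assms(1-3)]
  by (simp add: lin_combs_rat)

text \<open>The closure absorbs factor 1, to which the rule does not apply.\<close>

lemma red_steps_multiply:
  assumes "b > 0" "R \<noteq> {#}" "\<forall>r\<in>#R. r > 0"
  shows "red_step\<^sup>*\<^sup>* (add_mset b R) (add_mset (lcm b (Gcd (set_mset R))) R)"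
  using red_step_multiply[OF assms] by (cases "lcm b (Gcd (set_mset R)) = b") auto

lemma size_2_mset:
  assumes "size M = 2"
  obtains x y where "M = {#x, y#}"
proof -
  obtain x N where N: "M = add_mset x N"
    using assms size_eq_Suc_imp_eq_union[of M 1] by auto
  then have "size N = 1" using assms by simp
  with size_1_singleton_mset N that show ?thesis by blast
qed

text \<open>Both members grow to their least common multiple; then one copy is redundant and the
  other one independent.\<close>

lemma red_steps_pair:
  assumes "y > 0" "z > 0"
  shows "red_step\<^sup>*\<^sup>* {#y, z#} {#}"
proof -
  let ?l = "lcm y z"
  have l: "?l > 0" using assms by (rule lcm_pos_nat)
  have "red_step\<^sup>*\<^sup>* {#y, z#} {#?l, z#}"
    using red_steps_multiply[of y "{#z#}"] assms by simp
  also have "red_step\<^sup>*\<^sup>* {#?l, z#} {#?l, ?l#}"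
    using red_steps_multiply[of z "{#?l#}"] assms l
    by (simp add: add_mset_commute lcm.commute)
  also have "red_step {#?l, ?l#} {#?l#}"
    by (rule remove_redundant) (auto simp: lin_combs_insert intro!: exI[of _ 1])
  also have "red_step {#?l#} {#}" by (rule red_step_last[OF l])
  finally show ?thesis .
qed

section \<open>Gluing and the invariants of a triple\<close>

text \<open>The multiple \<open>B\<^sub>x x\<close> of the reduction is \<open>lcm x (gcd y z)\<close>.\<close>
definition gluable :: "nat \<Rightarrow> nat \<Rightarrow> nat \<Rightarrow> bool" where
  "gluable x y z \<longleftrightarrow> lcm x (gcd y z) \<in> lin_combs {y, z}"

definition gluable_triple :: "nat \<Rightarrow> nat \<Rightarrow> nat \<Rightarrow> bool" where
  "gluable_triple x y z \<longleftrightarrow> gluable x y z \<or> gluable y x z \<or> gluable z x y"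

lemma gluable_commute: "gluable x y z \<longleftrightarrow> gluable x z y"
  by (simp add: gluable_def gcd.commute insert_commute)

lemma gcd_lcm_distrib_nat: "gcd a (lcm b c) = lcm (gcd a b) (gcd a c)" for a b c :: nat
proof (cases "a = 0 \<or> b = 0 \<or> c = 0")
  case False
  have "prime_factorization (gcd a (lcm b c)) = prime_factorization (lcm (gcd a b) (gcd a c))"
    using False by (intro multiset_eqI)
      (simp add: prime_factorization_gcd prime_factorization_lcm min_max_distrib2)
  then show ?thesis
    using False prime_factorization_unique[of "gcd a (lcm b c)" "lcm (gcd a b) (gcd a c)"] by simp
qed (auto simp: lcm_proj1_if_dvd_nat lcm_proj2_if_dvd_nat)

text \<open>Multiplying \<open>x\<close> by its factor enlarges \<open>gcd x z\<close> only by
  \<open>gcd y z\<close>, which divides \<open>y\<close>, so the multiple to which \<open>y\<close>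
  would be raised stays the same. This makes multiplications commute.\<close>

lemma lcm_gcd_absorb: "lcm y (gcd (lcm x (gcd y z)) z) = lcm y (gcd x z)" for x y z :: nat
proof -
  have "gcd (lcm x (gcd y z)) z = lcm (gcd x z) (gcd (gcd y z) z)"
    by (metis gcd.commute gcd_lcm_distrib_nat)
  also have "gcd (gcd y z) z = gcd y z" by (simp add: gcd.assoc)
  finally show ?thesis
    by (metis gcd_dvd1 lcm.assoc lcm.commute lcm_proj1_if_dvd_nat)
qed

text \<open>The multiple \<open>?t\<close> of \<open>y\<close> is the same for \<open>x\<close> and
  \<open>x'\<close>. If it equals \<open>k * x + l * z\<close>, then \<open>gcd y z\<close> divides
  \<open>k * x\<close>, and hence so does \<open>x'\<close>.\<close>

lemma gluable_multiply:
  fixes x y z :: nat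
  defines "x' \<equiv> lcm x (gcd y z)"
  shows "gluable y x' z \<longleftrightarrow> gluable y x z"
proof -
  let ?t = "lcm y (gcd x z)"
  have t: "lcm y (gcd x' z) = ?t" unfolding x'_def by (rule lcm_gcd_absorb)
  have "(\<exists>k l. ?t = k * x' + l * z) \<longleftrightarrow> (\<exists>k l. ?t = k * x + l * z)"
  proof
    assume "\<exists>k l. ?t = k * x' + l * z"
    moreover obtain j where "x' = j * x" unfolding x'_def by (metis dvd_lcm1 dvdE mult.commute)
    ultimately show "\<exists>k l. ?t = k * x + l * z" by (metis mult.assoc)
  next
    assume "\<exists>k l. ?t = k * x + l * z"
    then obtain k l where kl: "?t = k * x + l * z" by blast
    have "gcd y z dvd ?t" by (meson dvd_lcm1 dvd_trans gcd_dvd1)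
    then have "gcd y z dvd k * x" unfolding kl by (simp add: dvd_add_left_iff)
    then have "x' dvd k * x" by (simp add: x'_def lcm_least)
    then show "\<exists>k l. ?t = k * x' + l * z" using kl by (metis dvdE mult.commute)
  qed
  then show ?thesis by (simp add: gluable_def lin_combs_nat2 t)
qed

lemma gluable_triple_multiply:
  "gluable_triple (lcm x (gcd y z)) y z \<longleftrightarrow> gluable_triple x y z"
proof -
  have "gluable (lcm x (gcd y z)) y z \<longleftrightarrow> gluable x y z"
    by (simp add: gluable_def lcm.assoc)
  moreover have "gluable y (lcm x (gcd y z)) z \<longleftrightarrow> gluable y x z"
    by (rule gluable_multiply)
  moreover have "gluable z (lcm x (gcd y z)) y \<longleftrightarrow> gluable z x y"
    using gluable_multiply[of z x y] by (simp add: gcd.commute)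
  ultimately show ?thesis by (simp add: gluable_triple_def)
qed

lemma gluable_triple_perm:
  "{#x, y, z#} = {#x', y', z'#} \<Longrightarrow> gluable_triple x y z \<longleftrightarrow> gluable_triple x' y' z'"
  by (auto simp: add_eq_conv_ex gluable_triple_def gluable_commute)

text \<open>The normal form of a positive triple that is not gluable.\<close>

definition multiplied :: "nat \<Rightarrow> nat \<Rightarrow> nat \<Rightarrow> nat multiset" where
  "multiplied x y z = {#lcm x (gcd y z), lcm y (gcd x z), lcm z (gcd x y)#}"

lemma multiplied_perm:
  "{#x, y, z#} = {#x', y', z'#} \<Longrightarrow> multiplied x y z = multiplied x' y' z'"
  by (auto simp: add_eq_conv_ex multiplied_def gcd.commute add_mset_commute)

lemma multiplied_multiply: "multiplied (lcm x (gcd y z)) y z = multiplied x y z"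
  using lcm_gcd_absorb[of y x z] lcm_gcd_absorb[of z x y]
  by (simp add: multiplied_def lcm.assoc gcd.commute)

lemma red_steps_gluable:
  assumes pos: "x > 0" "y > 0" "z > 0" and glu: "gluable x y z"
  shows "red_step\<^sup>*\<^sup>* {#x, y, z#} {#}"
proof -
  have "red_step\<^sup>*\<^sup>* {#x, y, z#} {#lcm x (gcd y z), y, z#}"
    using red_steps_multiply[of x "{#y, z#}"] pos by simp
  also have "red_step {#lcm x (gcd y z), y, z#} {#y, z#}"
    by (rule remove_redundant) (use glu in \<open>simp add: gluable_def insert_commute\<close>)
  also have "red_step\<^sup>*\<^sup>* {#y, z#} {#}" by (rule red_steps_pair[OF pos(2,3)])
  finally show ?thesis .
qed

lemma red_steps_triple:
  assumes pos: "x > 0" "y > 0" "z > 0" and glu: "gluable_triple x y z"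
  shows "red_step\<^sup>*\<^sup>* {#x, y, z#} {#}"
  using glu red_steps_gluable[of x y z] red_steps_gluable[of y x z] red_steps_gluable[of z x y] pos
  unfolding gluable_triple_def by (metis add_mset_commute)

text \<open>A single member is independent; of two members, equal ones are redundant and different
  ones cannot both equal their least common multiple; in a triple, \<open>x\<close> can be
  multiplied or removed.\<close>

lemma normal_empty:
  assumes M: "size M \<le> 2 \<or> (\<exists>x y z. M = {#x, y, z#} \<and> gluable x y z)"
    and pos: "\<forall>x\<in>#M. x > 0" and normal: "\<nexists>M'. red_step M M'"
  shows "M = {#}"
proof (rule ccontr)
  assume "M \<noteq> {#}"
  then have "size M \<noteq> 0" by simp
  then have "size M = 1 \<or> size M = 2 \<or> \<not> size M \<le> 2" by linarith
  then consider "size M = 1" | "size M = 2" | x y z where "M = {#x, y, z#}" "gluable x y z"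
    using M by blast
  then show False
  proof cases
    case 1
    then obtain b where "M = {#b#}" using size_1_singleton_mset by blast
    with red_step_last[of b] normal pos show ?thesis by auto
  next
    case 2
    then obtain x y where M_eq: "M = {#x, y#}" by (rule size_2_mset)
    then have "x > 0" "y > 0" using pos by auto
    show ?thesis
    proof (cases "x = y")
      case True
      have "red_step M {#y#}" unfolding M_eq True
        by (rule remove_redundant) (auto simp: lin_combs_insert intro!: exI[of _ 1])
      with normal show ?thesis by blast
    next
      case False
      then have "lcm x y \<noteq> x \<or> lcm y x \<noteq> y" by (metis lcm.commute)
      then show ?thesis
        using red_step_multiply[of x "{#y#}"] red_step_multiply[of y "{#x#}"] normal
          \<open>x > 0\<close> \<open>y > 0\<close> by (auto simp: M_eq add_mset_commute)
    qed
  next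
    case (3 x y z)
    show ?thesis
    proof (cases "lcm x (gcd y z) = x")
      case True
      then have "red_step M {#y, z#}" unfolding 3
        by (intro remove_redundant) (use 3(2) in \<open>simp add: gluable_def insert_commute\<close>)
      with normal show ?thesis by blast
    next
      case False
      then show ?thesis
        using red_step_multiply[of x "{#y, z#}"] 3 pos normal by auto
    qed
  qed
qed

text \<open>The invariant of the vanishing case: multiplication keeps a triple gluable, and a
  removal leaves at most two members.\<close>

lemma red_step_preserves:
  assumes "red_step M M'" and pos: "\<forall>x\<in>#M. x > 0"
    and M: "size M \<le> 2 \<or> (\<exists>x y z. M = {#x, y, z#} \<and> gluable_triple x y z)"
  shows "(\<forall>x\<in>#M'. x > 0) \<and>
    (size M' \<le> 2 \<or> (\<exists>x y z. M' = {#x, y, z#} \<and> gluable_triple x y z))"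
  using assms(1) pos
proof (cases rule: red_stepE)
  case (multiply b R)
  have "Gcd (set_mset R) \<noteq> 0" using multiply pos by auto
  then have pos': "\<forall>x\<in>#M'. x > 0"
    using multiply pos by (auto intro!: lcm_pos_nat)
  show ?thesis
  proof (cases "size M \<le> 2")
    case True
    then show ?thesis using multiply pos' by simp
  next
    case False
    then obtain x y z where xyz: "M = {#x, y, z#}" "gluable_triple x y z" using M by blast
    then have "size (add_mset b R) = 3" using multiply by simp
    then have "size R = 2" by simp
    then obtain q r where R: "R = {#q, r#}" by (rule size_2_mset)
    then have "gluable_triple b q r" using gluable_triple_perm[of x y z b q r] xyz multiply by simp
    then have "gluable_triple (lcm b (gcd q r)) q r" by (simp add: gluable_triple_multiply)
    then show ?thesis using multiply R pos' by auto
  qed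
next
  case (remove b R)
  have "size M \<le> 3" using M by auto
  then have "size M' \<le> 2" using remove by simp
  then show ?thesis using remove pos by auto
qed auto

text \<open>A redundant \<open>b\<close> is a multiple of the gcd of the other two, so its factor is
  1 and the triple would be gluable. Only multiplications remain, and they preserve
  \<open>multiplied\<close>.\<close>

lemma red_step_preserves_not:
  assumes "red_step M M'" and pos: "x > 0" "y > 0" "z > 0"
    and M: "M = {#x, y, z#}" "\<not> gluable_triple x y z"
  obtains x' y' z' where "M' = {#x', y', z'#}" "x' > 0" "y' > 0" "z' > 0"
    "\<not> gluable_triple x' y' z'" "multiplied x' y' z' = multiplied x y z"
proof -
  have pos': "\<forall>x\<in>#M. x > 0" using pos M by simp
  from assms(1) pos' show ?thesis
  proof (cases rule: red_stepE)
    case (remove_last b)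
    then show ?thesis using M by simp
  next
    case (remove b R)
    have "size M = 3" by (simp add: M(1))
    then have "size R = 2" using remove(2) by simp
    then obtain q r where R: "R = {#q, r#}" by (rule size_2_mset)
    then have eq: "{#x, y, z#} = {#b, q, r#}" using M(1) remove(2) by simp
    have "b \<in> lin_combs {q, r}" using remove R by (simp add: insert_commute)
    moreover from this obtain k l where "b = k * q + l * r" by (auto simp: lin_combs_nat2)
    then have "gcd q r dvd b" by simp
    ultimately have "gluable b q r"
      by (simp add: gluable_def lcm_proj1_if_dvd_nat)
    with M gluable_triple_perm[OF eq] show ?thesis by (simp add: gluable_triple_def)
  next
    case (multiply b R)
    have "size M = 3" by (simp add: M(1))
    then have "size R = 2" using multiply(2) by simp
    then obtain q r where R: "R = {#q, r#}" by (rule size_2_mset)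
    then have eq: "{#x, y, z#} = {#b, q, r#}" using M(1) multiply(2) by simp
    have M': "M' = {#lcm b (gcd q r), q, r#}" using multiply R by simp
    have bqr: "b > 0" "q > 0" "r > 0" using pos' multiply R by auto
    show ?thesis
      using M' bqr M gluable_triple_perm[OF eq] multiplied_perm[OF eq]
      by (intro that[of "lcm b (gcd q r)" q r])
        (auto simp: gluable_triple_multiply multiplied_multiply intro!: lcm_pos_nat)
  qed
qed

text \<open>The later multiples are computed from members that have already changed;
  \<open>lcm_gcd_absorb\<close> identifies them with those computed from \<open>x\<close>,
  \<open>y\<close>, \<open>z\<close>.\<close>

lemma red_steps_multiplied:
  assumes pos: "x > 0" "y > 0" "z > 0"
  shows "red_step\<^sup>*\<^sup>* {#x, y, z#} (multiplied x y z)"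
proof -
  let ?x = "lcm x (gcd y z)" and ?y = "lcm y (gcd x z)" and ?z = "lcm z (gcd x y)"
  have pos': "?x > 0" "?y > 0" using pos by (auto intro!: lcm_pos_nat)
  have "red_step\<^sup>*\<^sup>* {#x, y, z#} {#?x, y, z#}"
    using red_steps_multiply[of x "{#y, z#}"] pos by simp
  also have "{#?x, y, z#} = {#y, ?x, z#}" by simp
  also have "red_step\<^sup>*\<^sup>* {#y, ?x, z#} {#?y, ?x, z#}"
    using red_steps_multiply[of y "{#?x, z#}"] pos pos'
    by (simp add: lcm_gcd_absorb)
  also have "{#?y, ?x, z#} = {#z, ?y, ?x#}" by simp
  also have "red_step\<^sup>*\<^sup>* {#z, ?y, ?x#} {#?z, ?y, ?x#}"
  proof -
    have "lcm z (gcd ?y ?x) = lcm z (gcd y ?x)"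
      using lcm_gcd_absorb[of z y ?x] lcm_gcd_absorb[of y x z] by (simp add: gcd.commute)
    also have "\<dots> = ?z"
      using lcm_gcd_absorb[of z x y] by (simp add: gcd.commute)
    finally show ?thesis
      using red_steps_multiply[of z "{#?y, ?x#}"] pos pos' by simp
  qed
  also have "{#?z, ?y, ?x#} = multiplied x y z" by (simp add: multiplied_def add_mset_commute)
  finally show ?thesis .
qed

lemma normal_multiplied:
  assumes pos: "x > 0" "y > 0" "z > 0" and normal: "\<nexists>N. red_step {#x, y, z#} N"
  shows "multiplied x y z = {#x, y, z#}"
proof -
  have "lcm x (gcd y z) = x"
    using red_step_multiply[of x "{#y, z#}"] pos normal by auto
  moreover have "lcm y (gcd x z) = y"
    using red_step_multiply[of y "{#x, z#}"] pos normal by (auto simp: add_mset_commute)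
  moreover have "lcm z (gcd x y) = z"
    using red_step_multiply[of z "{#x, y#}"] pos normal by (auto simp: add_mset_commute)
  ultimately show ?thesis by (simp add: multiplied_def)
qed

text \<open>The definite description requires uniqueness, so each case combines a reachable normal
  form with an invariant that determines all reachable normal forms.\<close>

lemma reduced_family_triple:
  assumes pos: "x > 0" "y > 0" "z > 0"
  shows "reduced_family {#x, y, z#} = {#} \<longleftrightarrow> gluable_triple x y z"
proof (cases "gluable_triple x y z")
  case True
  have "\<nexists>N. red_step {#} N" by (auto elim: red_step.cases)
  moreover have "N = {#}" if N: "red_step\<^sup>*\<^sup>* {#x, y, z#} N" "\<nexists>N'. red_step N N'" for N
  proof -
    have inv: "(\<forall>a\<in>#N. a > 0) \<and>
        (size N \<le> 2 \<or> (\<exists>x y z. N = {#x, y, z#} \<and> gluable_triple x y z))"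
      using N(1)
    proof (induction rule: rtranclp_induct)
      case base
      then show ?case using True pos by auto
    next
      case (step M M')
      then show ?case using red_step_preserves by blast
    qed
    have "size N \<le> 2 \<or> (\<exists>x y z. N = {#x, y, z#} \<and> gluable x y z)"
      using inv unfolding gluable_triple_def by (metis add_mset_commute)
    with inv N(2) show ?thesis using normal_empty by blast
  qed
  ultimately have "reduced_family {#x, y, z#} = {#}"
    unfolding reduced_family_def using red_steps_triple[OF pos True] by (intro the_equality) auto
  with True show ?thesis by simp
next
  case False
  let ?N = "multiplied x y z"
  have inv: "\<exists>x' y' z'. N = {#x', y', z'#} \<and> x' > 0 \<and> y' > 0 \<and> z' > 0 \<and>
      \<not> gluable_triple x' y' z' \<and> multiplied x' y' z' = ?N"
    if "red_step\<^sup>*\<^sup>* {#x, y, z#} N" for N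
    using that
  proof (induction rule: rtranclp_induct)
    case base
    show ?case using False pos by blast
  next
    case (step M M')
    then obtain x' y' z' where "M = {#x', y', z'#}" "x' > 0" "y' > 0" "z' > 0"
      "\<not> gluable_triple x' y' z'" "multiplied x' y' z' = ?N" by blast
    with step.hyps(2) show ?case by (metis red_step_preserves_not)
  qed
  have "\<nexists>N'. red_step ?N N'"
  proof
    assume "\<exists>N'. red_step ?N N'"
    then obtain N' where N': "red_step ?N N'" by blast
    obtain x' y' z' where xyz': "N' = {#x', y', z'#}" "x' > 0" "y' > 0" "z' > 0"
      "multiplied x' y' z' = ?N"
      using inv[OF rtranclp.rtrancl_into_rtrancl[OF red_steps_multiplied[OF pos] N']] by blast
    \<comment> \<open>A multiplication would increase the sum of the family strictly, whereas each
      member of \<open>N'\<close> is at most its own multiple, and these multiples again form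
      \<open>multiplied x y z\<close>.\<close>
    have le: "\<Sum>\<^sub># N' \<le> \<Sum>\<^sub># ?N"
    proof -
      have le: "a \<le> lcm a (gcd b c)" if "a > 0" "b > 0" for a b c :: nat
        using that by (intro dvd_imp_le) (auto intro!: lcm_pos_nat)
      have "\<Sum>\<^sub># N' \<le> \<Sum>\<^sub># (multiplied x' y' z')"
        using add_mono[OF le[of x' y' z'] add_mono[OF le[of y' x' z'] le[of z' x' y']]] xyz'(2-4)
        by (simp add: xyz'(1) multiplied_def)
      then show ?thesis by (simp only: xyz'(5))
    qed
    have size: "size N' = size ?N" by (simp add: xyz'(1) multiplied_def)
    from N' show False
    proof (cases rule: red_step.cases)
      case (multiply b R)
      have "b \<in># ?N" by (simp add: multiply(1))
      then have b: "b > 0" using pos by (auto simp: multiplied_def intro!: lcm_pos_nat)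
      have "red_factor b R > 0"
      proof (rule ccontr)
        assume "\<not> red_factor b R > 0"
        then have "0 \<in># N'" using multiply(2) by simp
        with xyz' show False by auto
      qed
      then have "b < red_factor b R * b" using multiply(4) b by (cases "red_factor b R") auto
      with le show False by (simp add: multiply(1,2))
    qed (use size in auto)
  qed
  moreover have "N = ?N" if N: "red_step\<^sup>*\<^sup>* {#x, y, z#} N" "\<nexists>N'. red_step N N'" for N
    using inv[OF N(1)] N(2) normal_multiplied by metis
  ultimately have "reduced_family {#x, y, z#} = ?N"
    unfolding reduced_family_def using red_steps_multiplied[OF pos] by (intro the_equality) blast+
  with False show ?thesis by (simp add: multiplied_def)
qed

section \<open>Relations among the weights\<close>

text \<open>Without \<open>x_i\<close>, the monomial would write \<open>d i\<close> as a combination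
  of the other weights; with \<open>x_i\<close>, no weight is left for a further factor.\<close>

lemma minimal_generators_unique:
  assumes min: "minimal_generators n d" and pos: "\<forall>i\<in>{1..n}. d i > 0"
    and i: "i \<in> {1..n}" and v: "v \<in> exponents n" "weight d v = d i"
  shows "v = single i 1"
proof -
  interpret positive_weights n d by unfold_locales (use pos in simp)
  have "i \<in> keys v"
  proof (rule ccontr)
    assume "i \<notin> keys v"
    let ?A = "{1..n} - {i}"
    have "weight d v = (\<Sum>j\<in>?A. lookup v j * d j)"
      using v(1) \<open>i \<notin> keys v\<close> by (intro weight_eq_sum) (auto simp: exponents_def)
    \<comment> \<open>\<open>lin_combs\<close> uses the set of values of \<open>d\<close>, so
      exponents of indices with equal values are added up.\<close>
    also have "\<dots> = (\<Sum>b\<in>d ` ?A. \<Sum>j\<in>{j \<in> ?A. d j = b}. lookup v j * d j)"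
      by (rule sum.image_gen) simp
    also have "\<dots> = (\<Sum>b\<in>d ` ?A. (\<Sum>j\<in>{j \<in> ?A. d j = b}. lookup v j) * of_nat b)"
      unfolding sum_distrib_right by (intro sum.cong) auto
    finally have "d i \<in> lin_combs (d ` ?A)" using v(2) by (auto simp: lin_combs_def)
    with min i show False by (auto simp: minimal_generators_def)
  qed
  then have "1 \<le> lookup v i" by (simp add: in_keys_iff)
  then obtain v' where v': "v = v' + single i 1" by (rule exponent_split)
  then have "v' = 0" using weight_pos[of v'] v by auto
  with v' show ?thesis by simp
qed

text \<open>After cancelling a shared \<open>x_i\<close> the weight \<open>d j\<close> is left,
  which only \<open>x_j\<close> has. With \<open>i = j\<close> this isolates squares.\<close>

lemma two_variables_isolated:
  assumes min: "minimal_generators n d" and pos: "\<forall>i\<in>{1..n}. d i > 0"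
    and ij: "i \<in> {1..n}" "j \<in> {1..n}" and "conn n d (single i 1 + single j 1) v"
  shows "v = single i 1 + single j 1"
proof (rule conn_isolated[OF assms(5)])
  fix v k assume v: "v \<in> exponents n" "weight d v = weight d (single i 1 + single j 1)"
    and k: "k \<in> keys (single i 1 + single j 1 :: exponent)" "k \<in> keys v"
  have "1 \<le> lookup v k" using k(2) by (simp add: in_keys_iff)
  then obtain v' where v': "v = v' + single k 1" by (rule exponent_split)
  from k(1) have "k = i \<or> k = j" by (auto simp: keys_add_nat)
  then show "v = single i 1 + single j 1"
  proof
    assume "k = i"
    then have "v' = single j 1"
      using v v' by (intro minimal_generators_unique[OF min pos ij(2)]) auto
    with v' \<open>k = i\<close> show ?thesis by (simp add: add.commute)
  next
    assume "k = j"
    then have "v' = single i 1"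
      using v v' by (intro minimal_generators_unique[OF min pos ij(1)]) auto
    with v' \<open>k = j\<close> show ?thesis by simp
  qed
qed

section \<open>Exponent differences and normal forms\<close>

definition exponent_diff :: "exponent \<times> exponent \<Rightarrow> nat \<Rightarrow> int" where
  "exponent_diff b i = int (lookup (fst b) i) - int (lookup (snd b) i)"

text \<open>Each move changes the exponent vector by the difference of one generator.\<close>

lemma linked_combination:
  assumes "linked n {b0, b1, b2} u v"
  shows "\<exists>k0 k1 k2. \<forall>i. exponent_diff (u, v) i =
    k0 * exponent_diff b0 i + k1 * exponent_diff b1 i + k2 * exponent_diff b2 i"
  using assms
proof (induction rule: linked.induct)
  case (linked_move u v w)
  then consider "b0 = (u, v)" | "b1 = (u, v)" | "b2 = (u, v)" by blast
  then show ?case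
  proof cases
    case 1
    then show ?thesis
      by (intro exI[of _ 1] exI[of _ 0]) (simp add: exponent_diff_def lookup_add)
  next
    case 2
    then show ?thesis
      by (intro exI[of _ 0] exI[of _ 1] exI[of _ 0]) (simp add: exponent_diff_def lookup_add)
  next
    case 3
    then show ?thesis
      by (intro exI[of _ 0] exI[of _ 0] exI[of _ 1]) (simp add: exponent_diff_def lookup_add)
  qed
next
  case (linked_refl u)
  show ?case by (intro exI[of _ 0]) (simp add: exponent_diff_def)
next
  case (linked_sym u v)
  then obtain k0 k1 k2 where "\<And>i. exponent_diff (u, v) i =
    k0 * exponent_diff b0 i + k1 * exponent_diff b1 i + k2 * exponent_diff b2 i" by blast
  moreover have "exponent_diff (v, u) i = - exponent_diff (u, v) i" for i
    by (simp add: exponent_diff_def)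
  ultimately show ?case
    by (intro exI[of _ "-k0"] exI[of _ "-k1"] exI[of _ "-k2"]) simp
next
  case (linked_trans u v w)
  then obtain k0 k1 k2 l0 l1 l2 where
    "\<And>i. exponent_diff (u, v) i =
      k0 * exponent_diff b0 i + k1 * exponent_diff b1 i + k2 * exponent_diff b2 i"
    "\<And>i. exponent_diff (v, w) i =
      l0 * exponent_diff b0 i + l1 * exponent_diff b1 i + l2 * exponent_diff b2 i" by blast
  moreover have "exponent_diff (u, w) i = exponent_diff (u, v) i + exponent_diff (v, w) i" for i
    by (simp add: exponent_diff_def)
  ultimately show ?case
    by (intro exI[of _ "k0 + l0"] exI[of _ "k1 + l1"] exI[of _ "k2 + l2"])
      (simp add: distrib_right)
qed

text \<open>Rewriting \<open>x_i^r\<close> to \<open>x^q\<close> lowers the exponent of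
  \<open>x_i\<close>, as \<open>q\<close> does not contain it. Other variables outside
  \<open>q\<close> keep their exponents, so those reduced earlier can stay reduced.\<close>

lemma reduce_variable:
  assumes "(single i r, q) \<in> B" "r > 0" "i \<notin> keys q" "weight d q = r * d i" "q \<in> exponents n"
    and "u \<in> exponents n"
  shows "\<exists>u'\<in>exponents n. linked n B u u' \<and> weight d u' = weight d u \<and> lookup u' i < r \<and>
    (\<forall>j. j \<noteq> i \<longrightarrow> j \<notin> keys q \<longrightarrow> lookup u' j = lookup u j)"
  using assms(6)
proof (induction "lookup u i" arbitrary: u rule: less_induct)
  case less
  show ?case
  proof (cases "lookup u i < r")
    case True
    with less.prems show ?thesis by (blast intro: linked_refl)
  next
    case False
    then obtain u1 where u1: "u = u1 + single i r" by (meson exponent_split linorder_not_less)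
    have q: "u1 + q \<in> exponents n" "lookup (u1 + q) i < lookup u i"
      using less.prems u1 assms by (auto simp: lookup_add in_keys_iff)
    from less.hyps[OF q(2,1)] obtain u' where u': "u' \<in> exponents n" "linked n B (u1 + q) u'"
      "weight d u' = weight d (u1 + q)" "lookup u' i < r"
      "\<forall>j. j \<noteq> i \<longrightarrow> j \<notin> keys q \<longrightarrow> lookup u' j = lookup (u1 + q) j" by blast
    have "linked n B u (u1 + q)"
      unfolding u1 using less.prems u1 by (intro linked_move assms(1)) auto
    then have "linked n B u u'" using u'(2) by (rule linked_trans)
    moreover have "lookup (u1 + q) j = lookup u j" if "j \<noteq> i" "j \<notin> keys q" for j
      using that by (simp add: u1 lookup_add lookup_single in_keys_iff)
    ultimately show ?thesis
      using u' assms(4) by (intro bexI[of _ u']) (auto simp: u1)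
  qed
qed

lemma int_multiple_bounded:
  assumes "int r dvd int a - int b" "a < r" "b < r"
  shows "a = b"
  using assms dvd_imp_le_int[of "int a - int b" "int r"] by linarith

text \<open>Generators of the shape \<open>x\<^sub>w\<^bsup>r\<^esup> - \<dots>\<close>, where the second monomial contains only later variables,
  rewrite every monomial to a unique normal form.\<close>
lemma triangular_complete_intersection:
  assumes pos: "\<forall>i\<in>{1..4}. d i > 0"
    and perm: "distinct [w, x, y, z]" "{w, x, y, z} = {1..4}"
    and rw: "rw > 0" "rw * d w = s1 * d x + s2 * d y + s3 * d z"
      "\<And>e. int (gcd (d x) (gcd (d y) (d z))) dvd e * int (d w) \<Longrightarrow> int rw dvd e"
    and rx: "rx > 0" "rx * d x = t1 * d y + t2 * d z"
      "\<And>e. int (gcd (d y) (d z)) dvd e * int (d x) \<Longrightarrow> int rx dvd e"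
  shows "toric_complete_intersection TYPE('k::field) 4 d"
proof -
  interpret positive_weights 4 d by unfold_locales (use pos in simp)
  have mem: "w \<in> {1..4}" "x \<in> {1..4}" "y \<in> {1..4}" "z \<in> {1..4}" using perm(2) by blast+
  note in_exp = mem[THEN exponents_single]
  define g where "g = gcd (d y) (d z)"
  have dpos: "d y > 0" "d z > 0" using mem pos by auto
  \<comment> \<open>The third generator, \<open>y^ry - z^rz\<close>, is the only relation needed
    between the last two variables.\<close>
  obtain ry rz where ryz: "d z = ry * g" "d y = rz * g" "coprime ry rz" "g > 0"
    unfolding g_def using dpos gcd_coprime_exists[of "d z" "d y"]
    by (metis gcd.commute gcd_pos_nat neq0_conv)
  have "ry > 0" using ryz dpos by (cases ry) auto
  define q1 where "q1 = single x s1 + single y s2 + single z s3"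
  define q2 where "q2 = single y t1 + single z t2"
  define q3 where "q3 = single z rz"
  define B where "B = {(single w rw, q1), (single x rx, q2), (single y ry, q3)}"
  have q: "q1 \<in> exponents 4" "q2 \<in> exponents 4" "q3 \<in> exponents 4"
    by (auto simp: q1_def q2_def q3_def in_exp)
  have wt: "weight d q1 = rw * d w" "weight d q2 = rx * d x" "weight d q3 = ry * d y"
    using rw(2) rx(2) ryz by (simp_all add: q1_def q2_def q3_def)
  have keys_q: "w \<notin> keys q1" "w \<notin> keys q2" "x \<notin> keys q2" "w \<notin> keys q3" "x \<notin> keys q3" "y \<notin> keys q3"
    using perm(1) by (auto simp: q1_def q2_def q3_def keys_add_nat split: if_splits)
  have normal: "\<exists>u'\<in>exponents 4. linked 4 B u u' \<and> weight d u' = weight d u \<and>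
      lookup u' w < rw \<and> lookup u' x < rx \<and> lookup u' y < ry" if u: "u \<in> exponents 4" for u
  proof -
    obtain u1 where u1: "u1 \<in> exponents 4" "linked 4 B u u1" "weight d u1 = weight d u"
      "lookup u1 w < rw"
      using reduce_variable[OF _ rw(1) keys_q(1) wt(1) q(1) u, of B] by (auto simp: B_def)
    obtain u2 where u2: "u2 \<in> exponents 4" "linked 4 B u1 u2" "weight d u2 = weight d u1"
      "lookup u2 x < rx" "lookup u2 w = lookup u1 w"
      using reduce_variable[OF _ rx(1) keys_q(3) wt(2) q(2) u1(1), of B] perm(1) keys_q(2)
      by (auto simp: B_def)
    obtain u3 where u3: "u3 \<in> exponents 4" "linked 4 B u2 u3" "weight d u3 = weight d u2"
      "lookup u3 y < ry" "lookup u3 w = lookup u2 w" "lookup u3 x = lookup u2 x"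
      using reduce_variable[OF _ \<open>ry > 0\<close> keys_q(6) wt(3) q(3) u2(1), of B] perm(1) keys_q(4,5)
      by (auto simp: B_def)
    have "linked 4 B u u3" using u1 u2 u3 by (blast intro: linked_trans)
    with u1 u2 u3 show ?thesis by auto
  qed
  \<comment> \<open>The differences of the exponents of \<open>w\<close>, \<open>x\<close>,
    \<open>y\<close> are in turn multiples of \<open>rw\<close>, \<open>rx\<close>,
    \<open>ry\<close> and too small to be nonzero; the weight then settles \<open>z\<close>.\<close>
  have unique: "a = b" if a: "a \<in> exponents 4" "lookup a w < rw" "lookup a x < rx" "lookup a y < ry"
    and b: "b \<in> exponents 4" "lookup b w < rw" "lookup b x < rx" "lookup b y < ry"
    and ab: "weight d a = weight d b" for a b
  proof -
    have wt4: "int (weight d u) = int (lookup u w) * int (d w) + int (lookup u x) * int (d x) +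
        int (lookup u y) * int (d y) + int (lookup u z) * int (d z)" if "u \<in> exponents 4" for u
    proof -
      have "weight d u = (\<Sum>i\<in>{w, x, y, z}. lookup u i * d i)"
        using that by (intro weight_eq_sum) (simp_all add: exponents_def perm(2))
      then show ?thesis using perm(1) by (simp add: add.assoc)
    qed
    let ?D = "\<lambda>i. int (lookup a i) - int (lookup b i)"
    have eq: "?D w * int (d w) + ?D x * int (d x) + ?D y * int (d y) + ?D z * int (d z) = 0"
      using wt4[OF a(1)] wt4[OF b(1)] ab by (simp add: left_diff_distrib)
    have "?D w * int (d w) = (- ?D x) * int (d x) + ((- ?D y) * int (d y) + (- ?D z) * int (d z))"
      using eq by (simp add: algebra_simps)
    moreover have "int (gcd (d x) (gcd (d y) (d z))) dvd \<dots>"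
      by (intro dvd_add dvd_mult) (auto intro: dvd_trans[OF gcd_dvd2])
    ultimately have "int rw dvd ?D w" by (intro rw(3)) simp
    then have w: "lookup a w = lookup b w" using a(2) b(2) by (rule int_multiple_bounded)
    have "?D x * int (d x) = (- ?D y) * int (d y) + (- ?D z) * int (d z)"
      using eq w by (simp add: algebra_simps)
    moreover have "int (gcd (d y) (d z)) dvd \<dots>"
      by (intro dvd_add dvd_mult) auto
    ultimately have "int rx dvd ?D x" by (intro rx(3)) simp
    then have x: "lookup a x = lookup b x" using a(3) b(3) by (rule int_multiple_bounded)
    have "(?D y * int rz + ?D z * int ry) * int g = 0"
      using eq w x ryz(1,2) by (simp add: algebra_simps)
    then have "?D y * int rz + ?D z * int ry = 0" using ryz(4) by simp
    then have "?D y * int rz = - ?D z * int ry"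
      by (simp only: mult_minus_left eq_neg_iff_add_eq_0)
    then have "int ry dvd ?D y * int rz" by (metis dvd_triv_right)
    then have "int ry dvd ?D y" using ryz(3) by (simp add: coprime_dvd_mult_left_iff)
    then have y: "lookup a y = lookup b y" using a(4) b(4) by (rule int_multiple_bounded)
    have z: "lookup a z = lookup b z" using eq w x y dpos by simp
    show ?thesis
    proof (rule poly_mapping_eqI)
      fix i
      show "lookup a i = lookup b i"
      proof (cases "i \<in> {w, x, y, z}")
        case False
        then have "i \<notin> keys a" "i \<notin> keys b"
          using a(1) b(1) unfolding perm(2) by (auto simp: exponents_def)
        then show ?thesis by (simp add: in_keys_iff)
      qed (use w x y z in auto)
    qed
  qed
  have "presents 4 d B"
    unfolding presents_def
  proof (intro conjI ballI impI)
    fix b assume "b \<in> B"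
    then show "case b of (u, v) \<Rightarrow> u \<in> exponents 4 \<and> v \<in> exponents 4 \<and> weight d u = weight d v"
      using q wt in_exp by (auto simp: B_def)
  next
    fix u v assume uv: "u \<in> exponents 4" "v \<in> exponents 4" "weight d u = weight d v"
    obtain u' where u': "u' \<in> exponents 4" "linked 4 B u u'" "weight d u' = weight d u"
      "lookup u' w < rw" "lookup u' x < rx" "lookup u' y < ry" using normal[OF uv(1)] by blast
    obtain v' where v': "v' \<in> exponents 4" "linked 4 B v v'" "weight d v' = weight d v"
      "lookup v' w < rw" "lookup v' x < rx" "lookup v' y < ry" using normal[OF uv(2)] by blast
    have "u' = v'" using u' v' uv(3) by (intro unique) auto
    with u'(2) v'(2) show "linked 4 B u v" by (blast intro: linked_sym linked_trans)
  qed
  moreover have "card B \<le> 3" by (simp add: B_def card_insert_if)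
  ultimately show ?thesis by (intro complete_intersectionI[of B]) (auto simp: B_def)
qed

section \<open>Arithmetic consequences of three generators\<close>

lemma presentation_exponent_diff:
  assumes "presents n d {b0, b1, b2}" "u \<in> exponents n" "v \<in> exponents n"
    "weight d u = weight d v"
  obtains k0 k1 k2 where "\<And>i. exponent_diff (u, v) i =
    k0 * exponent_diff b0 i + k1 * exponent_diff b1 i + k2 * exponent_diff b2 i"
  using linked_combination[OF presents_linked[OF assms]] by blast

text \<open>In the relation \<open>x_i^(d j) - x_j^(d i)\<close> the exponent of \<open>x_j\<close>
  can only come from \<open>b0\<close>, hence in multiples of 2.\<close>

lemma even_second_weights:
  assumes B: "presents n d {b0, b1, b2}" and ij: "i \<in> {1..n}" "j \<in> {1..n}" "i \<noteq> j"
    and diff: "exponent_diff b0 j = -2" "exponent_diff b1 j = 0" "exponent_diff b2 j = 0"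
  shows "even (d i)"
proof -
  obtain k0 k1 k2 where k: "\<And>m. exponent_diff (single i (d j), single j (d i)) m =
      k0 * exponent_diff b0 m + k1 * exponent_diff b1 m + k2 * exponent_diff b2 m"
    using presentation_exponent_diff[OF B, of "single i (d j)" "single j (d i)"] ij
    by (auto simp: exponents_single)
  from k[of j] have "int (d i) = 2 * k0"
    using diff ij(3) by (simp add: exponent_diff_def lookup_single)
  then show ?thesis by presburger
qed

text \<open>A Bezout identity for \<open>d i\<close> and \<open>d j\<close> gives a relation with
  \<open>x_l^r\<close>, where \<open>r * d l\<close> is the least common multiple that gluability
  tests. It avoids \<open>x_m\<close>, which excludes \<open>b0\<close>; of the other two only
  \<open>b2\<close> changes the exponent of \<open>x_l\<close>, so \<open>\<rho>\<close> divides
  \<open>r\<close>.\<close>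

lemma presentation_gluable:
  assumes B: "presents n d {b0, b1, b2}"
    and mem: "{i, j, l, m} \<subseteq> {1..n}" "distinct [i, j, l, m]"
    and diff: "exponent_diff b0 m = -2" "exponent_diff b1 m = 0" "exponent_diff b2 m = 0"
      "exponent_diff b1 l = 0" "\<bar>exponent_diff b2 l\<bar> = int \<rho>"
    and \<rho>: "\<rho> * d l \<in> lin_combs {d i, d j}" and pos: "d i > 0" "d l > 0"
  shows "gluable (d l) (d i) (d j)"
proof -
  define g where "g = gcd (d i) (d j)"
  obtain r where r: "lcm (d l) g = r * d l" by (metis dvdE dvd_lcm1 mult.commute)
  obtain t where t: "r * d l = t * g" by (metis r dvdE dvd_lcm2 mult.commute)
  obtain x y where xy: "d i * x = d j * y + g" unfolding g_def using bezout_nat pos by blast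
  let ?u = "single i (x * t)" and ?v = "single j (y * t) + single l r"
  have "weight d ?u = weight d ?v"
    using arg_cong[OF xy, of "\<lambda>z. z * t"] t by (simp add: algebra_simps)
  then obtain k0 k1 k2 where k: "\<And>m. exponent_diff (?u, ?v) m =
      k0 * exponent_diff b0 m + k1 * exponent_diff b1 m + k2 * exponent_diff b2 m"
    using presentation_exponent_diff[OF B, of ?u ?v] mem by (auto simp: exponents_single)
  have "k0 = 0"
    using k[of m] diff mem(2) by (simp add: exponent_diff_def lookup_single lookup_add)
  then have "- int r = k2 * exponent_diff b2 l"
    using k[of l] diff mem(2) by (simp add: exponent_diff_def lookup_single lookup_add)
  then have "\<bar>exponent_diff b2 l\<bar> dvd int r" by (metis abs_dvd_iff dvd_minus_iff dvd_triv_right)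
  then have "\<rho> dvd r" using diff(5) by simp
  then obtain c where c: "r = \<rho> * c" by (rule dvdE)
  obtain a b where "\<rho> * d l = a * d i + b * d j" using \<rho> by (auto simp: lin_combs_nat2)
  then have "lcm (d l) g = (c * a) * d i + (c * b) * d j"
    unfolding r c by (metis (no_types, lifting) distrib_left mult.assoc mult.commute)
  then show ?thesis unfolding gluable_def g_def lin_combs_nat2 by blast
qed

text \<open>Two relations are tested. With \<open>g = gcd (d i) (d j)\<close>,
  \<open>x_i^(d j / g) - x_j^(d i / g)\<close> avoids \<open>x_l\<close>, which excludes
  \<open>b2\<close> and leaves multiples of 2 in \<open>x_j\<close>. A Bezout relation containing
  \<open>x_l^g\<close> forces \<open>\<rho>\<close> to divide \<open>g\<close>.\<close>

lemma presentation_last_weight: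
  assumes B: "presents n d {b0, b1, b2}"
    and mem: "{i, j, l} \<subseteq> {1..n}" "distinct [i, j, l]"
    and diff: "exponent_diff b0 j = -2" "exponent_diff b0 l = 0" "exponent_diff b1 j = 0"
      "exponent_diff b1 l = 0" "\<bar>exponent_diff b2 l\<bar> = int \<rho>" "\<rho> > 0"
    and pos: "d i > 0" "d j > 0"
  shows "even (d i div gcd (d i) (d j))" "\<rho> dvd gcd (d i) (d j)"
proof -
  define g where "g = gcd (d i) (d j)"
  have g: "g dvd d i" "g dvd d j" by (simp_all add: g_def)
  let ?u = "single i (d j div g)" and ?v = "single j (d i div g)"
  have "weight d ?u = weight d ?v" using g by (simp add: div_mult_swap mult.commute)
  then obtain k0 k1 k2 where k: "\<And>m. exponent_diff (?u, ?v) m =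
      k0 * exponent_diff b0 m + k1 * exponent_diff b1 m + k2 * exponent_diff b2 m"
    using presentation_exponent_diff[OF B, of ?u ?v] mem by (auto simp: exponents_single)
  have "exponent_diff b2 l \<noteq> 0" using diff(5,6) by auto
  moreover have "k2 * exponent_diff b2 l = 0"
    using k[of l] diff(2,4) mem(2) by (simp add: exponent_diff_def[of "(?u, ?v)"] lookup_single)
  ultimately have "k2 = 0" by simp
  then have "int (d i div g) = 2 * k0"
    using k[of j] diff mem(2) by (simp add: exponent_diff_def lookup_single)
  then have "even (int (d i div g))" by simp
  then show "even (d i div gcd (d i) (d j))" by (simp add: g_def)
  obtain x y where xy: "d i * x = d j * y + g" unfolding g_def using bezout_nat pos by blast
  let ?u = "single i (x * d l)" and ?v = "single j (y * d l) + single l g"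
  have "weight d ?u = weight d ?v"
    using arg_cong[OF xy, of "\<lambda>z. z * d l"] by (simp add: algebra_simps)
  then obtain k0 k1 k2 where k: "\<And>m. exponent_diff (?u, ?v) m =
      k0 * exponent_diff b0 m + k1 * exponent_diff b1 m + k2 * exponent_diff b2 m"
    using presentation_exponent_diff[OF B, of ?u ?v] mem by (auto simp: exponents_single)
  have "- int g = k2 * exponent_diff b2 l"
    using k[of l] diff mem(2) by (simp add: exponent_diff_def lookup_single lookup_add)
  then have "\<bar>exponent_diff b2 l\<bar> dvd int g" by (metis abs_dvd_iff dvd_minus_iff dvd_triv_right)
  then show "\<rho> dvd gcd (d i) (d j)" using diff(5) by (simp add: g_def)
qed

text \<open>The remaining generator is \<open>x\<^sub>1\<^sup>h x\<^sub>3 - x\<^sub>2\<^sup>2\<close>, which already meets \<open>{1, 2}\<close> and \<open>{2, 3}\<close> on both sides;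
  this is why the hypotheses on sets containing 2 are stronger.\<close>
lemma supports_of_generators:
  fixes U V U' V' :: "nat \<Rightarrow> bool"
  defines "hit \<equiv> \<lambda>(P :: nat \<Rightarrow> bool) (Q :: nat \<Rightarrow> bool) i j. (P i \<or> P j) \<and> (Q i \<or> Q j)"
  defines "hit3 \<equiv> \<lambda>(P :: nat \<Rightarrow> bool) (Q :: nat \<Rightarrow> bool) i j k.
    (P i \<or> P j \<or> P k) \<and> (Q i \<or> Q j \<or> Q k)"
  defines "power_binomial \<equiv>
    \<lambda>(P :: nat \<Rightarrow> bool) (Q :: nat \<Rightarrow> bool) (P' :: nat \<Rightarrow> bool) (Q' :: nat \<Rightarrow> bool) i j k l.
      P l \<and> \<not> P i \<and> \<not> P j \<and> \<not> P k \<and> \<not> Q l \<and> \<not> P' l \<and> \<not> Q' l \<and> \<not> P' 2 \<and> \<not> Q' 2"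
  assumes "U 1 \<or> U 2 \<or> U 3 \<or> U 4" "V 1 \<or> V 2 \<or> V 3 \<or> V 4"
    "U' 1 \<or> U' 2 \<or> U' 3 \<or> U' 4" "V' 1 \<or> V' 2 \<or> V' 3 \<or> V' 4"
    and "\<not> (U 1 \<and> V 1)" "\<not> (U 2 \<and> V 2)" "\<not> (U 3 \<and> V 3)" "\<not> (U 4 \<and> V 4)"
    and "\<not> (U' 1 \<and> V' 1)" "\<not> (U' 2 \<and> V' 2)" "\<not> (U' 3 \<and> V' 3)" "\<not> (U' 4 \<and> V' 4)"
    and "\<not> hit U V 1 2" "\<not> hit U V 2 3" "\<not> hit U' V' 1 2" "\<not> hit U' V' 2 3"
    and "\<not> (hit U V 1 3 \<and> hit U' V' 1 3)" "\<not> (hit U V 1 4 \<and> hit U' V' 1 4)"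
      "\<not> (hit U V 2 4 \<and> hit U' V' 2 4)" "\<not> (hit U V 3 4 \<and> hit U' V' 3 4)"
    and "\<not> (hit3 U V 1 2 4 \<and> hit3 U' V' 1 2 4)" "\<not> (hit3 U V 2 3 4 \<and> hit3 U' V' 2 3 4)"
  shows "power_binomial U V U' V' 1 2 3 4 \<or> power_binomial V U U' V' 1 2 3 4 \<or>
    power_binomial U' V' U V 1 2 3 4 \<or> power_binomial V' U' U V 1 2 3 4 \<or>
    power_binomial U V U' V' 2 3 4 1 \<and> \<not> V 2 \<or> power_binomial V U U' V' 2 3 4 1 \<and> \<not> U 2 \<or>
    power_binomial U' V' U V 2 3 4 1 \<and> \<not> V' 2 \<or> power_binomial V' U' U V 2 3 4 1 \<and> \<not> U' 2 \<or>
    power_binomial U V U' V' 1 2 4 3 \<and> \<not> V 2 \<or> power_binomial V U U' V' 1 2 4 3 \<and> \<not> U 2 \<or>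
    power_binomial U' V' U V 1 2 4 3 \<and> \<not> V' 2 \<or> power_binomial V' U' U V 1 2 4 3 \<and> \<not> U' 2"
  \<comment> \<open>The three groups of four disjuncts are \<open>l = 4\<close>,
    \<open>l = 1\<close> and \<open>l = 3\<close>; within a group they differ in which side of which
    generator is the pure power.\<close>
  using assms(4-) unfolding hit_def hit3_def power_binomial_def by sat

section \<open>Generalized arithmetic sequences\<close>

lemma dead_subset_card:
  assumes "card (dead B C) < card C" "finite B" "S \<subseteq> B"
    and "\<And>u v. (u, v) \<in> S \<Longrightarrow> keys u \<inter> C \<noteq> {} \<and> keys v \<inter> C \<noteq> {}"
  shows "card S < card C"
proof -
  have "card S \<le> card (dead B C)"
    using assms(2-4) by (intro card_mono) (auto simp: dead_def intro: finite_subset[of _ B])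
  with assms(1) show ?thesis by simp
qed

lemma complete_intersection_arith_imp_4:
  fixes d :: "nat \<Rightarrow> nat"
  assumes n: "n \<ge> 4" and pos: "\<forall>i\<in>{1..n}. d i > 0" and min: "minimal_generators n d"
    and h: "h > 0" "h * d 1 + d 3 = 2 * d 2"
    and arith: "n \<ge> 5 \<Longrightarrow> d 2 + d 4 = 2 * d 3" and less: "d 2 < d 3"
    and ci: "toric_complete_intersection TYPE('k::field) n d"
  shows "n = 4"
proof (rule ccontr)
  assume "n \<noteq> 4"
  with n have n5: "n \<ge> 5" by simp
  interpret positive_weights n d by unfold_locales (use pos in simp)
  let ?b1 = "(single 1 h + single 3 1, single 2 1 + single 2 1) :: exponent \<times> exponent"
  let ?b2 = "(single 2 1 + single 4 1, single 3 1 + single 3 1) :: exponent \<times> exponent"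
  have mem: "1 \<in> {1..n}" "2 \<in> {1..n}" "3 \<in> {1..n}" "4 \<in> {1..n}" using n5 by auto
  note in_exp = mem[THEN exponents_single]
  have not_conn: "\<not> conn n d u (single i 1 + single i 1)"
    if "i \<in> {1..n}" "j \<in> keys u" "j \<noteq> i" for u i j
  proof
    assume "conn n d u (single i 1 + single i 1)"
    then have "u = single i 1 + single i 1"
      using two_variables_isolated[OF min pos that(1) that(1)] conn_sym by blast
    with that show False by (auto simp: keys_add_nat split: if_splits)
  qed
  \<comment> \<open>The weights \<open>2 * d 2 < 2 * d 3\<close> of the two binomials differ, so one
    star can contain both.\<close>
  obtain B where B: "star n d B" "{?b1, ?b2} \<subseteq> B"
  proof (rule star_extension[of "{?b1, ?b2}"])
    fix u v assume "(u, v) \<in> {?b1, ?b2}"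
    then show "u \<in> exponents n \<and> v \<in> exponents n \<and> weight d u = weight d v \<and> \<not> conn n d u v"
      using not_conn[OF mem(2), of 3 "fst ?b1"] not_conn[OF mem(3), of 2 "fst ?b2"]
        h(2) arith[OF n5] by (auto simp: in_exp[simplified] keys_add_nat)
  next
    show "inj_on (weight d \<circ> fst) {?b1, ?b2}"
      using h(2) arith[OF n5] less by (auto simp: inj_on_def)
  qed
  have "card (dead B {2, 3}) < card {2, 3 :: nat}"
    using mem by (intro complete_intersection_dead[OF ci B(1)]) auto
  moreover have "finite B" using B(1) by (simp add: star_def)
  ultimately have "card {?b1, ?b2} < card {2, 3 :: nat}"
    using B(2) by (rule dead_subset_card) (auto simp: keys_add_nat)
  moreover have "?b1 \<noteq> ?b2"
    using less h(2) arith[OF n5] by (auto dest!: arg_cong[of _ _ "weight d"])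
  ultimately show False by simp
qed

lemma complete_intersection_4D:
  fixes d :: "nat \<Rightarrow> nat"
  assumes pos: "\<forall>i\<in>{1..4}. d i > 0" and min: "minimal_generators 4 d"
    and h: "h > 0" "h * d 1 + d 3 = 2 * d 2"
    and ci: "toric_complete_intersection TYPE('k::field) 4 d"
  shows "even (d 1 div gcd (d 1) (d 2)) \<and> gcd (d 1) (d 2) * d 4 \<in> lin_combs {d 1, d 2, d 3} \<or>
    even (d 1) \<and> even (d 4) \<and> reduced_family {#d 1, d 3, d 4#} = {#}"
    (is ?goal)
proof -
  interpret positive_weights 4 d by unfold_locales (use pos in simp)
  let ?b = "(single 1 h + single 3 1, single 2 1 + single 2 1) :: exponent \<times> exponent"
  have mem: "1 \<in> {1..4::nat}" "2 \<in> {1..4::nat}" "3 \<in> {1..4::nat}" "4 \<in> {1..4::nat}"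
    by auto
  note in_exp = mem[THEN exponents_single]
  have dpos: "d 1 > 0" "d 2 > 0" "d 3 > 0" "d 4 > 0" using pos by auto
  have not_conn: "\<not> conn 4 d (fst ?b) (snd ?b)"
  proof
    assume "conn 4 d (fst ?b) (snd ?b)"
    then have "fst ?b = single 2 1 + single 2 1"
      using two_variables_isolated[OF min pos mem(2) mem(2)] conn_sym by fastforce
    then have "lookup (fst ?b) 2 = lookup (snd ?b) 2" by simp
    then show False by (simp add: lookup_add lookup_single)
  qed
  obtain B where B: "star 4 d B" "?b \<in> B"
    using star_extension[of "{?b}"] not_conn h(2) in_exp by auto
  have fin: "finite B" and pres: "presents 4 d B" using B(1) by (auto simp: star_def)
  have "card B = 3" using ci complete_intersection_star[OF B(1), where 'k = 'k] by simp
  then have "card (B - {?b}) = 2" using B(2) fin by simp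
  then obtain b1 b2 where b12: "B - {?b} = {b1, b2}" "b1 \<noteq> b2" by (auto simp: card_2_iff)
  obtain u v u' v' where uv: "b1 = (u, v)" "b2 = (u', v')" by (cases b1, cases b2)
  have B_eq: "B = {?b, b1, b2}" using b12(1) B(2) by auto
  have ne: "b1 \<noteq> ?b" "b2 \<noteq> ?b" using b12(1) by auto
  have card_dead: "card (dead B C) < card C" if "C \<subseteq> {1..4}" "C \<noteq> {}" for C
    by (rule complete_intersection_dead[OF ci B(1) that])
  define hits where "hits b C \<longleftrightarrow> keys (fst b) \<inter> C \<noteq> {} \<and> keys (snd b) \<inter> C \<noteq> {}"
    for b :: "exponent \<times> exponent" and C
  have hits_card: "card S < card C" if "C \<subseteq> {1..4}" "C \<noteq> {}" "S \<subseteq> B" "\<And>b. b \<in> S \<Longrightarrow> hits b C"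
    for S C
    using dead_subset_card[OF card_dead[OF that(1,2)] fin that(3)] that(4)
    by (fastforce simp: hits_def)
  have hits0: "hits ?b C" if "2 \<in> C" "1 \<in> C \<or> 3 \<in> C" for C
    using that h(1) by (auto simp: hits_def keys_add_nat)
  have single: "\<not> hits b {i}" if "b \<in> B" "i \<in> {1..4}" for b i
    using hits_card[of "{i}" "{b}"] that by auto
  \<comment> \<open>Both sides of \<open>?b\<close> meet such a set, and at most one of the three
    generators may do so.\<close>
  have pair0: "\<not> hits b1 C" "\<not> hits b2 C" if "C = {1, 2} \<or> C = {2, 3}" for C
  proof -
    have C: "C \<subseteq> {1..4}" "C \<noteq> {}" "card C = 2" using that by auto
    have "hits ?b C" by (rule hits0) (use that in auto)
    then show "\<not> hits b1 C" "\<not> hits b2 C"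
      using hits_card[OF C(1,2), of "{?b, b1}"] hits_card[OF C(1,2), of "{?b, b2}"] C(3) ne
      by (auto simp: B_eq)
  qed
  have pair: "\<not> (hits b1 C \<and> hits b2 C)" if C: "C \<subseteq> {1..4}" "card C = 2" for C
  proof
    assume "hits b1 C \<and> hits b2 C"
    then have "hits b C" if "b \<in> {b1, b2}" for b using that by blast
    moreover have "C \<noteq> {}" using C(2) by auto
    ultimately have "card {b1, b2} < card C" using C(1) by (intro hits_card) (simp_all add: B_eq)
    with b12(2) C(2) show False by simp
  qed
  have triple: "\<not> (hits b1 C \<and> hits b2 C)"
    if C: "C \<subseteq> {1..4}" "card C = 3" "hits ?b C" for C
  proof
    assume "hits b1 C \<and> hits b2 C"
    then have "hits b C" if "b \<in> {?b, b1, b2}" for b using that C(3) by blast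
    moreover have "C \<noteq> {}" using C(2) by auto
    ultimately have "card {?b, b1, b2} < card C" using C(1) by (intro hits_card) (simp_all add: B_eq)
    with b12(2) ne[symmetric] C(2) show False by simp
  qed
  let ?U = "\<lambda>i. i \<in> keys u" and ?V = "\<lambda>i. i \<in> keys v"
  let ?U' = "\<lambda>i. i \<in> keys u'" and ?V' = "\<lambda>i. i \<in> keys v'"
  have uv_in: "(u, v) \<in> B" "(u', v') \<in> B" by (auto simp: B_eq uv)
  have nonempty: "keys x \<noteq> {} \<and> keys y \<noteq> {}" if "(x, y) \<in> B" for x y
  proof -
    have "\<not> conn 4 d x y" using B(1) that unfolding star_def by blast
    then have "x \<noteq> y" using conn_refl by auto
    then show ?thesis
      using presentsD[OF pres that] weight_pos[of x] weight_pos[of y] by auto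
  qed
  have some_var: "1 \<in> keys x \<or> 2 \<in> keys x \<or> 3 \<in> keys x \<or> 4 \<in> keys x"
    if "x \<in> exponents 4" "keys x \<noteq> {}" for x
  proof -
    have "keys x \<subseteq> {1, 2, 3, 4}" using that(1) by (auto simp: exponents_def subset_iff)
    with that(2) show ?thesis by blast
  qed
  \<comment> \<open>\<open>p\<close> is the pure power of \<open>x_l\<close> and \<open>b2'\<close>
    is its generator, in either orientation; \<open>b1'\<close> is the other generator besides
    \<open>?b\<close>.\<close>
  have finish: ?goal
    if p: "(p, q) \<in> {(u, v), (v, u), (u', v'), (v', u')}"
      and o: "b1' \<in> {b1, b2}" "b2' \<in> {b1, b2}" "b1' \<noteq> b2'" "b2' = (p, q) \<or> b2' = (q, p)"
      and l: "l \<in> {1, 3, 4}" and pl: "\<And>i. i \<in> {1..4} \<Longrightarrow> i \<in> keys p \<longleftrightarrow> i = l" "l \<notin> keys q"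
        "l = 4 \<or> 2 \<notin> keys q"
      and b1': "\<And>i. i = l \<or> i = 2 \<Longrightarrow> i \<notin> keys (fst b1') \<and> i \<notin> keys (snd b1')"
    for p q b1' b2' l
  proof -
    have B': "presents 4 d {?b, b1', b2'}"
    proof -
      have "{?b, b1', b2'} = B" using o by (auto simp: B_eq)
      with pres show ?thesis by simp
    qed
    have pq: "p \<in> exponents 4" "q \<in> exponents 4" "weight d p = weight d q"
      using p presentsD[OF pres uv_in(1)] presentsD[OF pres uv_in(2)] by auto
    define \<rho> where "\<rho> = lookup p l"
    have p_eq: "p = single l \<rho>"
    proof (rule poly_mapping_eqI)
      fix i
      have "i \<notin> keys p" if "i \<noteq> l"
        using pl(1)[of i] exponents_keysD[OF pq(1), of i] that by blast
      then show "lookup p i = lookup (single l \<rho>) i"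
        by (cases "i = l") (simp_all add: \<rho>_def lookup_single in_keys_iff)
    qed
    have "l \<in> {1..4}" using l by auto
    then have "\<rho> > 0" using pl(1)[of l] by (simp add: \<rho>_def in_keys_iff)
    have wt: "\<rho> * d l = weight d q" using pq(3) p_eq by simp
    have d0: "exponent_diff ?b 2 = -2" "exponent_diff ?b 4 = 0"
      by (simp_all add: exponent_diff_def lookup_add lookup_single)
    have d1: "exponent_diff b1' i = 0" if "i = l \<or> i = 2" for i
      using b1'[OF that] by (simp add: exponent_diff_def in_keys_iff)
    have d2: "\<bar>exponent_diff b2' l\<bar> = int \<rho>"
      using o(4) pl(2) by (auto simp: exponent_diff_def p_eq in_keys_iff)
    show ?goal
    proof (cases "l = 4")
      case True
      have mem': "{1, 2, l} \<subseteq> {1..4}" "distinct [1, 2, l]" using True by auto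
      have ev: "even (d 1 div gcd (d 1) (d 2))" and dvd: "\<rho> dvd gcd (d 1) (d 2)"
        using presentation_last_weight[OF B' mem' d0(1) _ d1 d1 d2 \<open>\<rho> > 0\<close> dpos(1,2)] d0(2) True
        by auto
      obtain c where c: "gcd (d 1) (d 2) = c * \<rho>" using dvd by (metis dvdE mult.commute)
      have "weight d q = (\<Sum>i\<in>{1, 2, 3}. lookup q i * d i)"
      proof (rule weight_eq_sum)
        have "keys q \<subseteq> {1, 2, 3, 4}" using pq(2) by (auto simp: exponents_def subset_iff)
        then show "keys q \<subseteq> {1, 2, 3}" using pl(2) True by auto
      qed simp
      moreover have "gcd (d 1) (d 2) * d 4 = c * weight d q"
        unfolding c using wt True by (simp add: mult.assoc)
      ultimately have "gcd (d 1) (d 2) * d 4 =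
          (c * lookup q 1) * d 1 + (c * lookup q 2) * d 2 + (c * lookup q 3) * d 3"
        by (simp add: distrib_left mult.assoc)
      then show ?goal using ev unfolding lin_combs_nat3 by blast
    next
      case False
      then have q2: "2 \<notin> keys q" and l13: "l = 1 \<or> l = 3" using pl(3) l by auto
      have d22: "exponent_diff b2' 2 = 0"
        using o(4) q2 l13 by (auto simp: exponent_diff_def p_eq in_keys_iff lookup_single)
      have ev: "even (d 1)" "even (d 4)"
        using even_second_weights[OF B' _ mem(2) _ d0(1) d1 d22] by auto
      \<comment> \<open>The index among 1 and 3 other than \<open>l\<close>: as \<open>q\<close>
        contains neither \<open>x_2\<close> nor \<open>x_l\<close>, it uses at most
        \<open>x_4\<close> and \<open>x_j\<close>.\<close>
      define j where "j = (if l = 1 then 3 else 1 :: nat)"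
      have mem': "{4, j, l, 2} \<subseteq> {1..4}" "distinct [4, j, l, 2]" using l13 by (auto simp: j_def)
      have "weight d q = (\<Sum>i\<in>{4, j}. lookup q i * d i)"
      proof (rule weight_eq_sum)
        have "keys q \<subseteq> {1, 2, 3, 4}" using pq(2) by (auto simp: exponents_def subset_iff)
        then show "keys q \<subseteq> {4, j}" using q2 pl(2) l13 by (auto simp: j_def)
      qed simp
      then have "\<rho> * d l \<in> lin_combs {d 4, d j}"
        using wt mem'(2) by (auto simp: lin_combs_nat2)
      then have "gluable (d l) (d 4) (d j)"
        using presentation_gluable[OF B' mem' d0(1) d1 d22 d1 d2] dpos l13 by auto
      then have "gluable_triple (d 1) (d 3) (d 4)"
        using l13 by (auto simp: gluable_triple_def j_def gluable_commute)
      then show ?goal using ev reduced_family_triple[OF dpos(1,3,4)] by simp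
    qed
  qed
  have V: "u \<in> exponents 4" "v \<in> exponents 4" "u' \<in> exponents 4" "v' \<in> exponents 4"
    using presentsD[OF pres uv_in(1)] presentsD[OF pres uv_in(2)] by auto
  note V' = nonempty[OF uv_in(1)] nonempty[OF uv_in(2)]
  have "\<not> (?U i \<and> ?V i)" "\<not> (?U' i \<and> ?V' i)" if "i \<in> {1..4}" for i
    using single[OF uv_in(1) that] single[OF uv_in(2) that] by (auto simp: hits_def)
  note disj = this[OF mem(1)] this[OF mem(2)] this[OF mem(3)] this[OF mem(4)]
  have p12: "\<not> hits b1 {1, 2}" "\<not> hits b2 {1, 2}" and p23: "\<not> hits b1 {2, 3}" "\<not> hits b2 {2, 3}"
    using pair0 by blast+
  have pairs: "\<not> (hits b1 {1, 3} \<and> hits b2 {1, 3})" "\<not> (hits b1 {1, 4} \<and> hits b2 {1, 4})"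
    "\<not> (hits b1 {2, 4} \<and> hits b2 {2, 4})" "\<not> (hits b1 {3, 4} \<and> hits b2 {3, 4})"
    by (rule pair; simp)+
  have triples: "\<not> (hits b1 {1, 2, 4} \<and> hits b2 {1, 2, 4})" "\<not> (hits b1 {2, 3, 4} \<and> hits b2 {2, 3, 4})"
    by (rule triple; (rule hits0)?; simp)+
  have hits2: "hits b {i, j} \<longleftrightarrow>
      (i \<in> keys (fst b) \<or> j \<in> keys (fst b)) \<and> (i \<in> keys (snd b) \<or> j \<in> keys (snd b))" for b i j
    by (auto simp: hits_def)
  have hits3: "hits b {i, j, k} \<longleftrightarrow>
      (i \<in> keys (fst b) \<or> j \<in> keys (fst b) \<or> k \<in> keys (fst b)) \<and>
      (i \<in> keys (snd b) \<or> j \<in> keys (snd b) \<or> k \<in> keys (snd b))" for b i j k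
    by (auto simp: hits_def)
  note supports = supports_of_generators[of ?U ?V ?U' ?V',
      OF some_var[OF V(1) conjunct1[OF V'(1)]] some_var[OF V(2) conjunct2[OF V'(1)]]
      some_var[OF V(3) conjunct1[OF V'(2)]] some_var[OF V(4) conjunct2[OF V'(2)]]
      disj(1,3,5,7) disj(2,4,6,8)
      p12(1)[unfolded hits2 uv fst_conv snd_conv] p23(1)[unfolded hits2 uv fst_conv snd_conv]
      p12(2)[unfolded hits2 uv fst_conv snd_conv] p23(2)[unfolded hits2 uv fst_conv snd_conv]
      pairs[unfolded hits2 uv fst_conv snd_conv] triples[unfolded hits3 uv fst_conv snd_conv]]
  have fin: ?goal
    if p: "(p, q, p', q', b1', b2') \<in> {(u, v, u', v', b2, b1), (v, u, u', v', b2, b1),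
        (u', v', u, v, b1, b2), (v', u', u, v, b1, b2)}"
      and l: "l \<in> {1, 3, 4}" "{i, j, k, l} = {1, 2, 3, 4}"
      and keys: "l \<in> keys p \<and> i \<notin> keys p \<and> j \<notin> keys p \<and> k \<notin> keys p \<and> l \<notin> keys q \<and>
        l \<notin> keys p' \<and> l \<notin> keys q' \<and> 2 \<notin> keys p' \<and> 2 \<notin> keys q'"
      and q2: "l = 4 \<or> 2 \<notin> keys q" for p q p' q' b1' b2' i j k l
  proof (rule finish[of p q b1' b2' l])
    fix m :: nat assume "m \<in> {1..4}"
    then have "m \<in> {i, j, k, l}" unfolding l(2) by auto
    with keys show "m \<in> keys p \<longleftrightarrow> m = l" by auto
  next
    fix m assume "m = l \<or> m = 2"
    with p keys show "m \<notin> keys (fst b1') \<and> m \<notin> keys (snd b1')" by (auto simp: uv)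
  qed (use p l(1) keys q2 b12(2) uv in auto)
  from supports show ?goal
  proof (elim disjE, goal_cases)
    case 1
    then show ?case by (intro fin[of u v u' v' b2 b1 4 1 2 3]) auto
  next
    case 2
    then show ?case by (intro fin[of v u u' v' b2 b1 4 1 2 3]) auto
  next
    case 3
    then show ?case by (intro fin[of u' v' u v b1 b2 4 1 2 3]) auto
  next
    case 4
    then show ?case by (intro fin[of v' u' u v b1 b2 4 1 2 3]) auto
  next
    case 5
    then show ?case by (intro fin[of u v u' v' b2 b1 1 2 3 4]) auto
  next
    case 6
    then show ?case by (intro fin[of v u u' v' b2 b1 1 2 3 4]) auto
  next
    case 7
    then show ?case by (intro fin[of u' v' u v b1 b2 1 2 3 4]) auto
  next
    case 8
    then show ?case by (intro fin[of v' u' u v b1 b2 1 2 3 4]) auto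
  next
    case 9
    then show ?case by (intro fin[of u v u' v' b2 b1 3 1 2 4]) auto
  next
    case 10
    then show ?case by (intro fin[of v u u' v' b2 b1 3 1 2 4]) auto
  next
    case 11
    then show ?case by (intro fin[of u' v' u v b1 b2 3 1 2 4]) auto
  next
    case 12
    then show ?case by (intro fin[of v' u' u v b1 b2 3 1 2 4]) auto
  qed
qed

section \<open>Sufficiency of the conditions\<close>

lemma gcd_dvd_third_weight:
  fixes a b c h :: nat
  assumes "h * a + c = 2 * b"
  shows "gcd a b dvd c"
  using assms by (metis dvd_add_right_iff dvd_mult gcd_dvd1 gcd_dvd2)

text \<open>The variables are eliminated in the order 4, 2, 1, 3, the first with exponent
  \<open>gcd (d 1) (d 2)\<close>, the second with exponent 2. Coprimality to \<open>d 4\<close>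
  makes the former minimal, parity the latter.\<close>

lemma complete_intersection_4I:
  fixes d :: "nat \<Rightarrow> nat"
  assumes pos: "\<forall>i\<in>{1..4}. d i > 0" and gcd: "coprime (gcd (d 1) (d 2)) (d 4)"
    and h: "h * d 1 + d 3 = 2 * d 2"
    and even: "even (d 1 div gcd (d 1) (d 2))"
    and lin: "gcd (d 1) (d 2) * d 4 \<in> lin_combs {d 1, d 2, d 3}"
  shows "toric_complete_intersection TYPE('k::field) 4 d"
proof -
  define g where "g = gcd (d 1) (d 2)"
  have dpos: "d 1 > 0" "d 2 > 0" "d 3 > 0" "d 4 > 0" using pos by auto
  have g: "g dvd d 1" "g dvd d 2" "g dvd d 3" "g > 0"
    using gcd_dvd_third_weight[OF h] dpos by (auto simp: g_def)
  obtain s1 s2 s3 where s: "g * d 4 = s1 * d 1 + s2 * d 2 + s3 * d 3"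
    using lin unfolding lin_combs_nat3 g_def by blast
  obtain a b where ab: "d 1 = a * g" "d 2 = b * g" "coprime a b"
    using gcd_coprime_exists[of "d 1" "d 2"] dpos unfolding g_def by (metis gcd_pos_nat neq0_conv)
  have "d 1 div g = a" using ab(1) g(4) by simp
  then have "even a" using even by (simp add: g_def)
  then have "odd b" using coprime_common_divisor_nat[OF ab(3), of 2] by auto
  show ?thesis
  proof (rule triangular_complete_intersection[OF pos, where w = 4 and x = 2 and y = 1 and z = 3])
    show "g * d 4 = s2 * d 2 + s1 * d 1 + s3 * d 3" using s by simp
    show "2 * d 2 = h * d 1 + 1 * d 3" using h by simp
    fix e :: int
    show "int g dvd e" if "int (gcd (d 2) (gcd (d 1) (d 3))) dvd e * int (d 4)"
    proof -
      have "int g dvd e * int (d 4)"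
        using dvd_trans[OF _ that, of "int g"] g by (simp add: g_def)
      then show ?thesis using gcd by (simp add: g_def coprime_dvd_mult_left_iff)
    qed
    show "int 2 dvd e" if "int (gcd (d 1) (d 3)) dvd e * int (d 2)"
    proof -
      \<comment> \<open>\<open>2 * g\<close> divides both \<open>d 1\<close> and \<open>d 3\<close>,
        while \<open>d 2 / g\<close> is odd; so \<open>e * d 2\<close> can be a multiple of
        \<open>gcd (d 1) (d 3)\<close> only for even \<open>e\<close>.\<close>
      have "2 * g dvd d 1" using \<open>even a\<close> ab(1) by (simp add: mult_dvd_mono)
      moreover have "2 * g dvd 2 * d 2" using g(2) by simp
      ultimately have "2 * g dvd d 3" using h by (metis dvd_add_right_iff dvd_mult)
      with \<open>2 * g dvd d 1\<close> have "int (2 * g) dvd int (gcd (d 1) (d 3))"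
        unfolding int_dvd_int_iff by (rule gcd_greatest)
      then have "int (2 * g) dvd e * int (b * g)" using that ab(2) by (metis dvd_trans)
      then have "2 * int g dvd (e * int b) * int g" by (simp add: mult.assoc)
      then have "2 dvd e * int b" using g(4) by simp
      then show ?thesis using \<open>odd b\<close> by simp
    qed
  qed (use g(4) in auto)
qed

text \<open>\<open>w\<close> is eliminated with exponent 2, minimal by parity, then \<open>x\<close>
  with the cofactor of \<open>d x\<close> in \<open>lcm (d x) (gcd (d y) (d z))\<close>, minimal
  because this is a least common multiple.\<close>

lemma complete_intersection_gluable:
  fixes d :: "nat \<Rightarrow> nat"
  assumes pos: "\<forall>i\<in>{1..4}. d i > 0" and perm: "distinct [w, x, y, z]" "{w, x, y, z} = {1..4}"
    and even: "even (d x)" "even (d y)" "even (d z)" and odd: "odd (d w)"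
    and w: "2 * d w = s1 * d x + s2 * d y + s3 * d z"
    and glu: "gluable (d x) (d y) (d z)"
  shows "toric_complete_intersection TYPE('k::field) 4 d"
proof -
  have dpos: "d x > 0" "d y > 0" "d z > 0"
    using pos perm(2) by blast+
  define r where "r = lcm (d x) (gcd (d y) (d z)) div d x"
  have r: "lcm (d x) (gcd (d y) (d z)) = r * d x" by (simp add: r_def)
  have "lcm (d x) (gcd (d y) (d z)) > 0" using dpos by (intro lcm_pos_nat) auto
  then have "r > 0" using r by (cases r) auto
  obtain t1 t2 where t: "r * d x = t1 * d y + t2 * d z"
    using glu unfolding gluable_def lin_combs_nat2 r by blast
  show ?thesis
  proof (rule triangular_complete_intersection[OF pos perm _ w _ \<open>r > 0\<close> t])
    fix e :: int
    show "int 2 dvd e" if "int (gcd (d x) (gcd (d y) (d z))) dvd e * int (d w)"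
    proof -
      have "int 2 dvd int (gcd (d x) (gcd (d y) (d z)))" using even by simp
      then have "int 2 dvd e * int (d w)" using that by (rule dvd_trans)
      with odd show ?thesis by simp
    qed
    show "int r dvd e" if "int (gcd (d y) (d z)) dvd e * int (d x)"
    proof -
      have "lcm (int (d x)) (int (gcd (d y) (d z))) dvd e * int (d x)"
        using that by (intro lcm_least) auto
      then have "int r * int (d x) dvd e * int (d x)"
        using arg_cong[OF r, of int] by (simp add: lcm_int_int_eq)
      then show ?thesis using dpos by simp
    qed
  qed simp
qed

theorem theorem3p9:
  fixes n :: nat and d :: "nat \<Rightarrow> nat"
  assumes "n \<ge> 4"
    and "\<forall>i\<in>{1..n}. d i > 0"
    and "generalized_arith_seq (n - 1) d"
    and "Gcd (d ` {1..n}) = 1"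
    and "minimal_generators n d"
  shows "toric_complete_intersection TYPE('k::field) n d \<longleftrightarrow>
    n = 4 \<and>
    (even (d 1 div gcd (d 1) (d 2)) \<and> gcd (d 1) (d 2) * d 4 \<in> lin_combs {d 1, d 2, d 3}
     \<or> even (d 1) \<and> even (d 4) \<and> reduced_family {#d 1, d 3, d 4#} = {#})"
proof -
  obtain h e where h: "h > 0" and e: "e > 0"
    and step: "\<And>i. i \<in> {1..<n - 1} \<Longrightarrow> (d(1 := h * d 1)) (Suc i) = (d(1 := h * d 1)) i + e"
    using assms(3) unfolding generalized_arith_seq_def increasing_arith_seq_def by blast
  have d2: "d 2 = h * d 1 + e" using step[of 1] assms(1) by (simp add: numeral_2_eq_2)
  have d3: "d 3 = d 2 + e" using step[of 2] assms(1) by simp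
  \<comment> \<open>The progression ends at \<open>d (n - 1)\<close>, so \<open>d 4\<close> belongs
    to it only from \<open>n = 5\<close> on.\<close>
  have d4: "d 4 = d 3 + e" if "n \<ge> 5" using step[of 3] that by simp
  have rel: "h * d 1 + d 3 = 2 * d 2" using d2 d3 by simp
  show ?thesis
  proof
    assume ci: "toric_complete_intersection TYPE('k) n d"
    have "n = 4"
      using complete_intersection_arith_imp_4[OF assms(1,2,5) h rel _ _ ci] d3 d4 e by simp
    moreover have "even (d 1 div gcd (d 1) (d 2)) \<and> gcd (d 1) (d 2) * d 4 \<in> lin_combs {d 1, d 2, d 3} \<or>
        even (d 1) \<and> even (d 4) \<and> reduced_family {#d 1, d 3, d 4#} = {#}"
      using complete_intersection_4D[OF _ _ h rel, where 'k = 'k] ci assms(2,5) \<open>n = 4\<close> by simp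
    ultimately show "n = 4 \<and>
      (even (d 1 div gcd (d 1) (d 2)) \<and> gcd (d 1) (d 2) * d 4 \<in> lin_combs {d 1, d 2, d 3}
       \<or> even (d 1) \<and> even (d 4) \<and> reduced_family {#d 1, d 3, d 4#} = {#})" by blast
  next
    assume rhs: "n = 4 \<and>
      (even (d 1 div gcd (d 1) (d 2)) \<and> gcd (d 1) (d 2) * d 4 \<in> lin_combs {d 1, d 2, d 3}
       \<or> even (d 1) \<and> even (d 4) \<and> reduced_family {#d 1, d 3, d 4#} = {#})"
    then have n: "n = 4" by blast
    have pos: "\<forall>i\<in>{1..4}. d i > 0" using assms(2) n by simp
    then have dpos: "d 1 > 0" "d 3 > 0" "d 4 > 0" by auto
    have set4: "{1..4} = {1, 2, 3, 4 :: nat}" by auto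
    have common: "m = 1" if "m dvd d 1" "m dvd d 2" "m dvd d 3" "m dvd d 4" for m
    proof -
      have "m dvd Gcd (d ` {1..n})"
        using that by (intro Gcd_greatest) (auto simp: n set4 simp del: One_nat_def)
      with assms(4) show ?thesis by simp
    qed
    from rhs consider
      "even (d 1 div gcd (d 1) (d 2))" "gcd (d 1) (d 2) * d 4 \<in> lin_combs {d 1, d 2, d 3}"
      | "even (d 1)" "even (d 4)" "reduced_family {#d 1, d 3, d 4#} = {#}" by blast
    then show "toric_complete_intersection TYPE('k) n d"
    proof cases
      case 1
      have "coprime (gcd (d 1) (d 2)) (d 4)"
      proof (rule coprimeI)
        fix m assume "m dvd gcd (d 1) (d 2)" "m dvd d 4"
        then show "is_unit m"
          using common[of m] dvd_trans[OF _ gcd_dvd_third_weight[OF rel]] by auto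
      qed
      then show ?thesis unfolding n by (rule complete_intersection_4I[OF pos _ rel 1])
    next
      case 2
      note ev14 = 2(1,2)
      have ev: "even (h * d 1 + d 3)" unfolding rel by simp
      then have ev3: "even (d 3)" using 2(1) by simp
      have odd: "odd (d 2)" using common[of 2] 2(1,2) ev3 by auto
      have "gluable_triple (d 1) (d 3) (d 4)"
        using reduced_family_triple[OF dpos] 2(3) by simp
      then consider "gluable (d 1) (d 3) (d 4)" | "gluable (d 3) (d 1) (d 4)" | "gluable (d 4) (d 1) (d 3)"
        unfolding gluable_triple_def by blast
      then show ?thesis
        unfolding n
      proof cases
        case 1
        then show "toric_complete_intersection TYPE('k) 4 d"
          using rel ev14 ev3 odd
          \<comment> \<open>The indices are 2, the gluable variable and the other two; then come the
            coefficients of \<open>2 * d 2 = h * d 1 + d 3\<close> in the order of these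
            three.\<close>
          by (intro complete_intersection_gluable[OF pos, of 2 1 3 4 h 1 0]) auto
      next
        case 2
        then show "toric_complete_intersection TYPE('k) 4 d"
          using rel ev14 ev3 odd
          by (intro complete_intersection_gluable[OF pos, of 2 3 1 4 1 h 0]) auto
      next
        case 3
        then show "toric_complete_intersection TYPE('k) 4 d"
          using rel ev14 ev3 odd
          by (intro complete_intersection_gluable[OF pos, of 2 4 1 3 0 h 1]) auto
      qed
    qed
  qed
qed

end
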